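(* Let $H$ be a $5$-degenerate graph with $n$ vertices and $m$ edges. Then $s_2(H)=n+m$.
   Context: Graphs are finite and simple. $\mathbb{Z}_q$ denotes the cyclic group of order $q$. A $\mathbb{Z}_q$-edge-weighted $K_f$ is the complete graph $K_f$ on $f$ vertices equipped with a weight function $\omega:E(K_f)\to\mathbb{Z}_q$ (arbitrary). The weight of a path is the sum in $\mathbb{Z}_q$ of the weights of its edges. A subdivision of a graph $H$ is a graph obtained from $H$ by replacing each edge of $H$ by a path (a subdivision path) of length at least $1$ with the same endpoints, where the internal vertices of these paths are new and the paths are pairwise internally disjoint. A $q$-divisible subdivision of $H$ in a $\mathbb{Z}_q$-edge-weighted $K_f$ is a subgraph of $K_f$ that is a subdivision of $H$ in which every subdivision path has weight $0$ in $\mathbb{Z}_q$. For an integer $q\ge 2$, $s_q(H)$ denotes the minimum $f$ such that every $\mathbb{Z}_q$-edge-weighted $K_f$ contains a $q$-divisible subdivision of $H$. Here $q=2$. *)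

theory Defs
  imports "HOL-Algebra.Elementary_Groups" "HOL-Algebra.FiniteProduct" "HOL-Library.Extended_Nat"
begin

record 'a ugraph =
  verts :: "'a set"
  edges :: "'a set set"

definition simple_graph :: "'a ugraph \<Rightarrow> bool" where
  "simple_graph G \<longleftrightarrow>
     finite (verts G) \<and> (\<forall>e\<in>edges G. e \<subseteq> verts G \<and> card e = 2)"

definition subgraph_of :: "'a ugraph \<Rightarrow> 'a ugraph \<Rightarrow> bool" where
  "subgraph_of G' G \<longleftrightarrow>
     simple_graph G' \<and> verts G' \<subseteq> verts G \<and> edges G' \<subseteq> edges G"

definition vertex_degree :: "'a ugraph \<Rightarrow> 'a \<Rightarrow> nat" where
  "vertex_degree G v = card {e \<in> edges G. v \<in> e}"

definition degenerate :: "nat \<Rightarrow> 'a ugraph \<Rightarrow> bool" where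
  "degenerate d G \<longleftrightarrow>
     (\<forall>G'. subgraph_of G' G \<and> verts G' \<noteq> {} \<longrightarrow> (\<exists>v\<in>verts G'. vertex_degree G' v \<le> d))"

definition complete_graph :: "nat \<Rightarrow> nat ugraph" where
  "complete_graph f = \<lparr>verts = {..<f}, edges = {e. e \<subseteq> {..<f} \<and> card e = 2}\<rparr>"

text \<open>Paths are given by their vertex sequences.\<close>

definition path_edges :: "'a list \<Rightarrow> 'a set set" where
  "path_edges p = {{p ! i, p ! Suc i} | i. Suc i < length p}"

definition is_path :: "'a ugraph \<Rightarrow> 'a list \<Rightarrow> bool" where
  "is_path G p \<longleftrightarrow> p \<noteq> [] \<and> distinct p \<and> set p \<subseteq> verts G \<and> path_edges p \<subseteq> edges G"

definition internal_verts :: "'a list \<Rightarrow> 'a set" where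
  "internal_verts p = set p - {hd p, last p}"

text \<open>
  The graph \<open>S\<close> is a subdivision of \<open>H\<close>, where \<open>\<phi>\<close> maps the vertices of \<open>H\<close> to the branch
  vertices of \<open>S\<close>, and \<open>P e\<close> is the subdivision path replacing the edge \<open>e\<close> of \<open>H\<close>,
  traversed in one of its two directions. Its length is at least 1 because \<open>\<phi> ` e\<close> has
  two elements.
\<close>

definition subdivision_of ::
  "'b ugraph \<Rightarrow> 'a ugraph \<Rightarrow> ('a \<Rightarrow> 'b) \<Rightarrow> ('a set \<Rightarrow> 'b list) \<Rightarrow> bool" where
  "subdivision_of S H \<phi> P \<longleftrightarrow>
     inj_on \<phi> (verts H) \<and>
     (\<forall>e\<in>edges H. is_path S (P e) \<and> {hd (P e), last (P e)} = \<phi> ` e) \<and>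
     (\<forall>e\<in>edges H. internal_verts (P e) \<inter> \<phi> ` verts H = {}) \<and>
     (\<forall>e\<in>edges H. \<forall>e'\<in>edges H.
        e \<noteq> e' \<longrightarrow> internal_verts (P e) \<inter> internal_verts (P e') = {}) \<and>
     verts S = \<phi> ` verts H \<union> (\<Union>e\<in>edges H. set (P e)) \<and>
     edges S = (\<Union>e\<in>edges H. path_edges (P e))"

text \<open>
  The group \<open>integer_mod_group q\<close> is written multiplicatively: \<open>finprod\<close> is the sum
  in \<open>\<int>/q\<close>, and its unit is 0. Since paths do not repeat vertices, summing over the set
  of edges of a path counts every edge once.
\<close>

definition edge_weighting :: "nat \<Rightarrow> 'a ugraph \<Rightarrow> ('a set \<Rightarrow> int) \<Rightarrow> bool" where
  "edge_weighting q G \<omega> \<longleftrightarrow> (\<forall>e\<in>edges G. \<omega> e \<in> carrier (integer_mod_group q))"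

definition path_weight :: "nat \<Rightarrow> ('a set \<Rightarrow> int) \<Rightarrow> 'a list \<Rightarrow> int" where
  "path_weight q \<omega> p = finprod (integer_mod_group q) \<omega> (path_edges p)"

definition has_divisible_subdivision ::
  "nat \<Rightarrow> 'b ugraph \<Rightarrow> ('b set \<Rightarrow> int) \<Rightarrow> 'a ugraph \<Rightarrow> bool" where
  "has_divisible_subdivision q G \<omega> H \<longleftrightarrow>
     (\<exists>S \<phi> P. subgraph_of S G \<and> subdivision_of S H \<phi> P \<and>
        (\<forall>e\<in>edges H. path_weight q \<omega> (P e) = \<one>\<^bsub>integer_mod_group q\<^esub>))"

text \<open>
  The minimum is taken in the extended naturals, so that \<open>s_div q H = enat k\<close> includes the
  assertion that the minimum exists (the infimum of the empty set is \<open>\<infinity>\<close>).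
\<close>

definition s_div :: "nat \<Rightarrow> 'a ugraph \<Rightarrow> enat" where
  "s_div q H = Inf {enat f | f. \<forall>\<omega>. edge_weighting q (complete_graph f) \<omega> \<longrightarrow>
                        has_divisible_subdivision q (complete_graph f) \<omega> H}"

end

theory Submission
  imports Defs "HOL-Library.Disjoint_Sets"
begin

text \<open>
Call an edge of \<open>K\<^sub>f\<close> red if its weight is 1 and blue if it is 0; a path has weight 0 iff it
has an even number of red edges.

The lower bound comes from the colouring with all edges red: every subdivision path then has even
length, hence an internal vertex of its own, and a subdivision uses at least \<open>n + m\<close> vertices.

For the upper bound, the subdivision is built by induction on the number of vertices of \<open>H\<close>. Let
\<open>v\<close> be a vertex of minimum degree \<open>d\<close>, so that \<open>d \<le> 5\<close>, \<open>d < n\<close> and \<open>d n \<le> 2 m\<close>. The idea is to set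
aside a set \<open>X\<close> of \<open>d + 1\<close> vertices, to embed \<open>H - v\<close> into the other vertices, and then to place \<open>v\<close>
at some \<open>x \<in> X\<close> and to join it to the images \<open>t\<close> of its \<open>d\<close> neighbours by disjoint even paths whose
internal vertices lie in \<open>X - {x}\<close>. Only \<open>d + 1\<close> vertices are spent, which is the exact budget, but
nothing is known about the colours between \<open>X\<close> and the targets, so \<open>X\<close> must work for all of them.

There are two ways to make connections. A target that is red to \<open>x\<close> is joined through any \<open>y \<in> X\<close>
with \<open>x y\<close> and \<open>y t\<close> of the same colour. An odd triangle, that is one with an odd number of
red edges, joins \<open>x\<close> to every target, because its vertices can be used in paths of both parities; if
\<open>x\<close> lies on the triangle, the other two vertices suffice. If a set contains no odd triangle, its
colouring is a cut, and one side of the cut is a large blue clique; as soon as there is a blue clique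
with \<open>n\<close> vertices, \<open>H\<close> itself embeds into it.

Which \<open>X\<close> is taken depends on a maximum red clique \<open>K\<close>. By maximality every vertex outside \<open>K\<close>
has a blue edge to \<open>K\<close>, so no target is red to all of \<open>K\<close>, while inside \<open>K\<close> everything is red.
If \<open>card K > d\<close>, a maximal matching of targets into \<open>K\<close> leaves some \<open>x\<close>
unmatched, and the matching joins \<open>x\<close> to its red targets (\<open>large_clique_linked\<close>). If \<open>card K = d \<ge> 3\<close>,
a perfect matching can be repaired (\<open>full_size_clique_linked\<close>). If \<open>K\<close> is smaller, then \<open>X\<close>
contains \<open>K\<close>, or an odd triangle when \<open>card K = 2\<close>, and for \<open>d \<ge> 4\<close> also vertices of a second odd
triangle, which exists since otherwise the remaining vertices contain a large blue clique. For \<open>d \<le> 5\<close>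
this leaves the situations of \<open>edge_linked_one_triangle\<close>, \<open>edge_linked_two_triangles\<close>,
\<open>triangle_linked_five\<close>, \<open>four_clique_linked\<close>, \<open>edge_linked_four\<close> and \<open>triangle_linked_four\<close>.
They are settled by counting the red edges between \<open>X\<close> and the targets. The choice of \<open>X\<close> is made in
\<open>exists_attaching_set\<close>, and the induction is \<open>even_subdivision_exists\<close>.
\<close>

section \<open>Even walks through a set of spare vertices\<close>

text \<open>
\<open>R x y\<close> says that the edge \<open>x y\<close> is red; the other edges are blue.
\<close>

locale coloring =
  fixes R :: "'b \<Rightarrow> 'b \<Rightarrow> bool"
  assumes R_sym: "R x y \<longleftrightarrow> R y x"
begin

fun odd_walk :: "'b list \<Rightarrow> bool" where
  "odd_walk (x # y # p) = (R x y \<noteq> odd_walk (y # p))"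
| "odd_walk _ = False"

definition odd3 :: "'b \<Rightarrow> 'b \<Rightarrow> 'b \<Rightarrow> bool" where
  "odd3 x y z \<longleftrightarrow> (R x y \<noteq> (R y z \<noteq> R x z))"

text \<open>
Neither \<open>x\<close> nor \<open>u\<close> is excluded from \<open>S\<close>; that both lie outside is ensured at the places of use.
\<close>

definition serves :: "'b \<Rightarrow> 'b set \<Rightarrow> 'b \<Rightarrow> bool" where
  "serves x S u \<longleftrightarrow> (\<exists>ys. distinct ys \<and> set ys \<subseteq> S \<and> \<not> odd_walk (x # ys @ [u]))"

lemma serves_one: "R x y = R y u \<Longrightarrow> y \<in> S \<Longrightarrow> serves x S u"
  unfolding serves_def by (rule exI[of _ "[y]"]) auto

lemma serves_pair: "R x y = (R y z \<noteq> R z u) \<Longrightarrow> y \<noteq> z \<Longrightarrow> y \<in> S \<Longrightarrow> z \<in> S \<Longrightarrow> serves x S u"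
  unfolding serves_def by (rule exI[of _ "[y, z]"]) auto

text \<open>
If \<open>p\<close>, \<open>q\<close> and the pair \<open>p, q\<close> all failed, then the edges at \<open>u\<close> would cancel and \<open>x p q\<close> would be
even.
\<close>

lemma serves_triangle_through:
  assumes "odd3 x p q" "p \<noteq> q" "p \<in> S" "q \<in> S"
  shows "serves x S u"
proof (rule ccontr)
  assume no: "\<not> serves x S u"
  have "R x p \<noteq> R p u" "R x q \<noteq> R q u" "R x p \<noteq> (R p q \<noteq> R q u)"
    using no assms(2-) serves_one[of x p u S] serves_one[of x q u S] serves_pair[of x p q u S] by blast+
  then show False
    using assms(1) unfolding odd3_def by blast
qed

text \<open>
If no single vertex of the triangle works, then the parities of the three paths from \<open>x\<close> to \<open>u\<close>
over an edge of the triangle add up to one more than the parity of the triangle, so they are not all odd.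
\<close>

lemma serves_triangle:
  assumes "odd3 p q s" "distinct [p, q, s]" "{p, q, s} \<subseteq> S"
  shows "serves x S u"
proof (rule ccontr)
  assume no: "\<not> serves x S u"
  have ne: "p \<noteq> q" "q \<noteq> s" "p \<noteq> s" and S: "p \<in> S" "q \<in> S" "s \<in> S"
    using assms(2,3) by auto
  note one = serves_one[of x _ u S] and pair = serves_pair[of x _ _ u S]
  have "R x p \<noteq> R p u" using no one[of p] S by blast
  moreover have "R x q \<noteq> R q u" using no one[of q] S by blast
  moreover have "R x s \<noteq> R s u" using no one[of s] S by blast
  moreover have "R x p \<noteq> (R p q \<noteq> R q u)" using no pair[of p q] S ne by blast
  moreover have "R x q \<noteq> (R q s \<noteq> R s u)" using no pair[of q s] S ne by blast
  moreover have "R x p \<noteq> (R p s \<noteq> R s u)" using no pair[of p s] S ne by blast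
  ultimately show False
    using assms(1) unfolding odd3_def by auto
qed

text \<open>
A new vertex placed at \<open>x\<close> can be joined to all targets \<open>t i\<close> by even paths whose internal vertices
lie in \<open>X\<close> and are not shared. The targets are indexed so that \<open>t\<close> can be the embedding restricted to
the neighbours of the new vertex.
\<close>

definition linked :: "'b set \<Rightarrow> 'i set \<Rightarrow> ('i \<Rightarrow> 'b) \<Rightarrow> 'b \<Rightarrow> bool" where
  "linked X I t x \<longleftrightarrow> x \<in> X \<and> (\<exists>c. disjoint_family_on (\<lambda>i. set (c i)) I \<and>
     (\<forall>i\<in>I. distinct (c i) \<and> set (c i) \<subseteq> X - {x} \<and> \<not> odd_walk (x # c i @ [t i])))"

text \<open>
The targets that cannot be reached from \<open>x\<close> by a single blue edge.
\<close>

definition bad :: "'i set \<Rightarrow> ('i \<Rightarrow> 'b) \<Rightarrow> 'b \<Rightarrow> 'i set" where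
  "bad I t x = {i \<in> I. R x (t i)}"

text \<open>
Only the bad targets need spare vertices, since the others are joined to \<open>x\<close> by their blue edge.
\<close>

lemma linkedI:
  assumes "x \<in> X"
    and srv: "\<And>i. i \<in> bad I t x \<Longrightarrow> serves x (S i) (t i)"
    and sub: "\<And>i. i \<in> bad I t x \<Longrightarrow> S i \<subseteq> X - {x}"
    and disj: "\<And>i j. i \<in> bad I t x \<Longrightarrow> j \<in> bad I t x \<Longrightarrow> i \<noteq> j \<Longrightarrow> S i \<inter> S j = {}"
  shows "linked X I t x"
proof -
  define c0 where "c0 i = (SOME ys. distinct ys \<and> set ys \<subseteq> S i \<and> \<not> odd_walk (x # ys @ [t i]))" for i
  have c0: "distinct (c0 i) \<and> set (c0 i) \<subseteq> S i \<and> \<not> odd_walk (x # c0 i @ [t i])"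
    if "i \<in> bad I t x" for i
    unfolding c0_def by (rule someI_ex) (use srv[OF that] in \<open>simp add: serves_def\<close>)
  define c where "c = (\<lambda>i. if i \<in> bad I t x then c0 i else [])"
  have "disjoint_family_on (\<lambda>i. set (c i)) I"
    unfolding disjoint_family_on_def
  proof (intro ballI impI)
    fix m n assume "m \<in> I" "n \<in> I" "m \<noteq> n"
    show "set (c m) \<inter> set (c n) = {}"
    proof (cases "m \<in> bad I t x \<and> n \<in> bad I t x")
      case True
      then have "set (c m) \<subseteq> S m" "set (c n) \<subseteq> S n" "S m \<inter> S n = {}"
        using c0 disj[of m n] \<open>m \<noteq> n\<close> by (simp_all add: c_def)
      then show ?thesis by blast
    next
      case False
      then have "c m = [] \<or> c n = []" unfolding c_def by presburger
      then show ?thesis by force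
    qed
  qed
  moreover have "distinct (c i) \<and> set (c i) \<subseteq> X - {x} \<and> \<not> odd_walk (x # c i @ [t i])" if "i \<in> I" for i
  proof (cases "i \<in> bad I t x")
    case True
    then show ?thesis using c0[OF True] sub[OF True] by (auto simp: c_def)
  next
    case False
    then show ?thesis using that by (simp add: c_def bad_def)
  qed
  ultimately show ?thesis
    unfolding linked_def using assms(1) by blast
qed

lemma linked4:
  assumes "x \<in> X" "bad I t x \<subseteq> {i, j, k, l}" "distinct [i, j, k, l]"
    and "serves x A (t i)" "serves x B (t j)" "serves x C (t k)" "serves x D (t l)"
    and "A \<union> B \<union> C \<union> D \<subseteq> X - {x}"
    and "A \<inter> B = {}" "A \<inter> C = {}" "A \<inter> D = {}" "B \<inter> C = {}" "B \<inter> D = {}" "C \<inter> D = {}"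
  shows "linked X I t x"
proof -
  define S where "S = (\<lambda>n. if n = i then A else if n = j then B else if n = k then C else D)"
  have S: "S i = A" "S j = B" "S k = C" "S l = D"
    using assms(3) by (auto simp: S_def)
  show ?thesis
  proof (rule linkedI[where S = S])
    fix m assume "m \<in> bad I t x"
    then have "m = i \<or> m = j \<or> m = k \<or> m = l" using assms(2) by blast
    then show "serves x (S m) (t m)" "S m \<subseteq> X - {x}"
      using S assms(4-8) by auto
    fix n assume "n \<in> bad I t x" "m \<noteq> n"
    then have "n = i \<or> n = j \<or> n = k \<or> n = l" using assms(2) by blast
    with \<open>m = i \<or> m = j \<or> m = k \<or> m = l\<close> \<open>m \<noteq> n\<close> show "S m \<inter> S n = {}"
      using S assms(9-) by (metis Int_commute)
  qed (fact assms(1))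
qed

lemma linked3:
  assumes "x \<in> X" "bad I t x \<subseteq> {i, j, k}" "distinct [i, j, k]"
    and "serves x A (t i)" "serves x B (t j)" "serves x C (t k)"
    and "A \<union> B \<union> C \<subseteq> X - {x}" "A \<inter> B = {}" "A \<inter> C = {}" "B \<inter> C = {}"
  shows "linked X I t x"
proof -
  define S where "S = (\<lambda>n. if n = i then A else if n = j then B else C)"
  have S: "S i = A" "S j = B" "S k = C"
    using assms(3) by (auto simp: S_def)
  show ?thesis
  proof (rule linkedI[where S = S])
    fix m assume "m \<in> bad I t x"
    then have "m = i \<or> m = j \<or> m = k" using assms(2) by blast
    then show "serves x (S m) (t m)" "S m \<subseteq> X - {x}"
      using S assms(4-7) by auto
    fix n assume "n \<in> bad I t x" "m \<noteq> n"
    then have "n = i \<or> n = j \<or> n = k" using assms(2) by blast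
    with \<open>m = i \<or> m = j \<or> m = k\<close> \<open>m \<noteq> n\<close> show "S m \<inter> S n = {}"
      using S assms(8-) by (metis Int_commute)
  qed (fact assms(1))
qed

lemma linked2:
  assumes "x \<in> X" "bad I t x \<subseteq> {i, j}"
    and "serves x A (t i)" "serves x B (t j)"
    and "A \<union> B \<subseteq> X - {x}" "A \<inter> B = {}"
  shows "linked X I t x"
proof (rule linkedI[where S = "\<lambda>n. if n = i then A else B"])
  fix m assume "m \<in> bad I t x"
  then have m: "m = i \<or> m = j" using assms(2) by blast
  then show "serves x (if m = i then A else B) (t m)" "(if m = i then A else B) \<subseteq> X - {x}"
    using assms(3-5) by auto
  fix n assume "n \<in> bad I t x" "m \<noteq> n"
  then have "n = i \<or> n = j" using assms(2) by blast
  with m \<open>m \<noteq> n\<close> show "(if m = i then A else B) \<inter> (if n = i then A else B) = {}"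
    using assms(6) by auto
qed (fact assms(1))

lemma card_le_2E:
  assumes "finite A" "card A \<le> 2"
  obtains i j where "A \<subseteq> {i, j}"
proof (cases "A = {}")
  case True then show ?thesis using that by blast
next
  case False
  then obtain i where i: "i \<in> A" by blast
  then have "card (A - {i}) \<le> 1" using assms by simp
  then have "A - {i} = {} \<or> (\<exists>j. A - {i} = {j})"
    using assms(1) by (metis card_1_singletonE card_eq_0_iff finite_Diff le_neq_implies_less less_one)
  then show ?thesis using that by blast
qed

text \<open>
Two disjoint sets that serve every target are enough when there are at most two bad targets; this is
how odd triangles are used.
\<close>

lemma linked_universal2:
  assumes "x \<in> X" "finite I" "card (bad I t x) \<le> 2"
    and "\<And>u. serves x A u" "\<And>u. serves x B u"
    and "A \<union> B \<subseteq> X - {x}" "A \<inter> B = {}"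
  shows "linked X I t x"
proof -
  have "finite (bad I t x)" using assms(2) by (simp add: bad_def)
  then obtain i j where "bad I t x \<subseteq> {i, j}"
    using assms(3) card_le_2E by blast
  then show ?thesis by (rule linked2[OF assms(1) _ assms(4,5,6,7)])
qed

lemma linked_universal1:
  assumes "x \<in> X" "finite I" "card (bad I t x) \<le> 1"
    and "\<And>u. serves x A u" "A \<subseteq> X - {x}"
  shows "linked X I t x"
proof (rule linkedI[where S = "\<lambda>_. A"])
  have "finite (bad I t x)" using assms(2) by (simp add: bad_def)
  then show "A \<inter> A = {}" if "i \<in> bad I t x" "j \<in> bad I t x" "i \<noteq> j" for i j
    using that assms(3) card_le_Suc0_iff_eq[of "bad I t x"] by simp
qed (use assms in auto)

section \<open>Red cliques with at least as many vertices as targets\<close>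

definition red_clique :: "'b set \<Rightarrow> bool" where
  "red_clique K \<longleftrightarrow> (\<forall>x\<in>K. \<forall>y\<in>K. x \<noteq> y \<longrightarrow> R x y)"

lemma red_cliqueD: "red_clique K \<Longrightarrow> x \<in> K \<Longrightarrow> y \<in> K \<Longrightarrow> x \<noteq> y \<Longrightarrow> R x y"
  unfolding red_clique_def by blast

text \<open>
Take a maximal matching of targets into \<open>K\<close> by red edges. If some \<open>x \<in> K\<close> is unmatched, then by
maximality all its bad targets are matched, and the partners of these targets join them to \<open>x\<close>.
\<close>

lemma unlinked_clique_matched:
  fixes t :: "'i \<Rightarrow> 'b"
  assumes fin: "finite I" and KX: "K \<subseteq> X" and clique: "red_clique K"
    and nolink: "\<And>x. x \<in> K \<Longrightarrow> \<not> linked X I t x"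
  obtains J g where "J \<subseteq> I" "bij_betw g J K" "\<And>i. i \<in> J \<Longrightarrow> R (g i) (t i)"
proof -
  define M where "M = {J. J \<subseteq> I \<and> (\<exists>g. inj_on g J \<and> g ` J \<subseteq> K \<and> (\<forall>i\<in>J. R (g i) (t i)))}"
  have "M \<subseteq> Pow I" by (auto simp: M_def)
  then have finM: "finite (card ` M)" using fin finite_subset by (metis finite_Pow_iff finite_imageI)
  moreover have "{} \<in> M" by (simp add: M_def)
  ultimately have "Max (card ` M) \<in> card ` M" by (intro Max_in) auto
  then obtain J where JM: "J \<in> M" "card J = Max (card ` M)" by auto
  have max: "card J' \<le> card J" if "J' \<in> M" for J'
    unfolding JM(2) using finM that by (intro Max_ge) auto
  from JM(1) obtain g where J: "J \<subseteq> I" and g: "inj_on g J" "g ` J \<subseteq> K" "\<And>i. i \<in> J \<Longrightarrow> R (g i) (t i)"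
    by (auto simp: M_def)
  have "g ` J = K"
  proof (rule ccontr)
    assume "g ` J \<noteq> K"
    then obtain x where x: "x \<in> K" "x \<notin> g ` J" using g(2) by blast
    have bad: "bad I t x \<subseteq> J"
    proof
      fix i assume i: "i \<in> bad I t x"
      show "i \<in> J"
      proof (rule ccontr)
        assume "i \<notin> J"
        have "insert i J \<in> M"
        proof -
          have "inj_on (g(i := x)) (insert i J)"
            using g(1) x(2) \<open>i \<notin> J\<close> by (auto simp: inj_on_def)
          moreover have "(g(i := x)) ` insert i J \<subseteq> K" using g(2) x(1) by auto
          moreover have "\<forall>k\<in>insert i J. R ((g(i := x)) k) (t k)"
            using g(3) i by (auto simp: bad_def)
          moreover have "insert i J \<subseteq> I" using J i by (auto simp: bad_def)
          ultimately show ?thesis unfolding M_def by blast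
        qed
        from max[OF this] show False
          using \<open>i \<notin> J\<close> J fin by (simp add: finite_subset)
      qed
    qed
    have "linked X I t x"
    proof (rule linkedI[where S = "\<lambda>i. {g i}"])
      show "x \<in> X" using x(1) KX by blast
      fix i assume "i \<in> bad I t x"
      then have i: "i \<in> J" using bad by blast
      then have "R x (g i)" using x g(2) red_cliqueD[OF clique] by blast
      then show "serves x {g i} (t i)" using g(3)[OF i] by (intro serves_one[of x "g i"]) simp_all
      show "{g i} \<subseteq> X - {x}" using i g(2) KX x(2) by blast
      fix j assume "j \<in> bad I t x" "i \<noteq> j"
      then show "{g i} \<inter> {g j} = {}" using i bad g(1) by (auto dest: inj_onD)
    qed
    then show False using nolink x(1) by blast
  qed
  then have "bij_betw g J K" using g(1) by (simp add: bij_betw_def)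
  then show ?thesis using that J g(3) by blast
qed

lemma large_clique_linked:
  fixes t :: "'i \<Rightarrow> 'b"
  assumes "finite I" "K \<subseteq> X" "red_clique K" "card I < card K"
  shows "\<exists>x\<in>K. linked X I t x"
proof (rule ccontr)
  assume "\<not> ?thesis"
  then obtain J g where "J \<subseteq> I" "bij_betw g J K"
    using unlinked_clique_matched[OF assms(1-3), of t] by metis
  then have "card K \<le> card I"
    using assms(1) by (metis bij_betw_same_card card_mono)
  then show False using assms(4) by simp
qed

text \<open>
Suppose that no centre works. By \<open>unlinked_clique_matched\<close> there is a perfect matching; let \<open>f y\<close> be the
target matched with \<open>y\<close>. At a centre \<open>x\<close> every bad target except \<open>f x\<close> can use its own partner, so only
\<open>f x\<close> needs help. If two vertices \<open>a\<close>, \<open>b\<close> are matched with targets that are not bad at \<open>x\<close>, they are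
free and form an odd triangle with \<open>x\<close>. Hence at most one target is blue to each vertex. As each target is blue to some vertex, the blue
pairs form a permutation without fixed points, and then a shift along one or two vertices frees a connector.
\<close>

lemma full_size_clique_linked:
  fixes t :: "'i \<Rightarrow> 'b"
  assumes fin: "finite I" and KX: "K \<subseteq> X" and clique: "red_clique K"
    and card: "card K = card I" "3 \<le> card K"
    and miss_ex: "\<And>i. i \<in> I \<Longrightarrow> \<exists>y\<in>K. \<not> R y (t i)"
  shows "\<exists>x\<in>K. linked X I t x"
proof (rule ccontr)
  assume nolink: "\<not> ?thesis"
  then obtain J g where J: "J \<subseteq> I" and bij: "bij_betw g J K" and red: "\<And>i. i \<in> J \<Longrightarrow> R (g i) (t i)"
    using unlinked_clique_matched[OF fin KX clique, of t] by metis
  have "J = I"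
    using J bij card(1) fin by (metis bij_betw_same_card card_subset_eq)
  note bij = bij[unfolded this] and red = red[unfolded this]
  have finK: "finite K" using bij fin bij_betw_finite by blast
  define f where "f = inv_into I g"
  have gf: "g (f y) = y" "f y \<in> I" if "y \<in> K" for y
    using that bij unfolding f_def bij_betw_def by (auto simp: f_inv_into_f inv_into_into)
  have fg: "f (g i) = i" "g i \<in> K" if "i \<in> I" for i
    using that bij unfolding f_def bij_betw_def by (auto simp: inv_into_f_f)
  have f_inj: "f y = f z \<longleftrightarrow> y = z" if "y \<in> K" "z \<in> K" for y z
    using gf(1)[OF that(1)] gf(1)[OF that(2)] by metis
  have g_inj: "g i = g j \<longleftrightarrow> i = j" if "i \<in> I" "j \<in> I" for i j
    using fg(1)[OF that(1)] fg(1)[OF that(2)] by metis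
  define miss where "miss y = {z \<in> K. \<not> R y (t (f z))}" for y
  have not_self: "y \<notin> miss y" if "y \<in> K" for y
    using red[OF gf(2)[OF that]] gf(1)[OF that] by (simp add: miss_def)
  have link: "linked X I t x"
    if x: "x \<in> K" and S: "\<And>i. i \<in> bad I t x \<Longrightarrow> serves x (S i) (t i)" "\<And>i. i \<in> bad I t x \<Longrightarrow> S i \<subseteq> K - {x}"
      "\<And>i j. i \<in> bad I t x \<Longrightarrow> j \<in> bad I t x \<Longrightarrow> i \<noteq> j \<Longrightarrow> S i \<inter> S j = {}" for x S
    by (rule linkedI[where S = S]) (use x S KX in blast)+
  have own: "serves x {y} (t i)" if "x \<in> K" "y \<in> K" "x \<noteq> y" "R y (t i)" for x y i
    using red_cliqueD[OF clique that(1-3)] that(4) by (intro serves_one[of x y]) simp_all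
  \<comment> \<open>The target \<open>f x\<close> of the centre \<open>x\<close> takes the free vertices \<open>a\<close> and \<open>b\<close>.\<close>
  have unique: "a = b" if x: "x \<in> K" and ab: "a \<in> miss x" "b \<in> miss x" for x a b
  proof (rule ccontr)
    assume "a \<noteq> b"
    have K: "a \<in> K" "b \<in> K" "a \<noteq> x" "b \<noteq> x"
      using ab not_self[OF x] by (auto simp: miss_def)
    define S where "S = (\<lambda>i. if i = f x then {a, b} else {g i})"
    have S: "S i = {a, b} \<and> i = f x \<or> S i = {g i} \<and> g i \<noteq> x \<and> g i \<noteq> a \<and> g i \<noteq> b \<and> i \<noteq> f x"
      if "i \<in> bad I t x" for i
      using that ab fg by (auto simp: S_def bad_def miss_def)
    have "linked X I t x"
    proof (rule link[OF x])
      fix i assume i: "i \<in> bad I t x"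
      then have iI: "i \<in> I" and Ri: "R x (t i)" by (auto simp: bad_def)
      have "odd3 x a b"
        using red_cliqueD[OF clique] K x \<open>a \<noteq> b\<close> unfolding odd3_def by metis
      then show "serves x (S i) (t i)"
        using S[OF i] own[of x "g i" i] x fg(2)[OF iI] red[OF iI] \<open>a \<noteq> b\<close>
        by (auto intro: serves_triangle_through)
      show "S i \<subseteq> K - {x}" using S[OF i] K fg(2)[OF iI] by auto
      fix j assume j: "j \<in> bad I t x" "i \<noteq> j"
      then have "j \<in> I" by (auto simp: bad_def)
      then show "S i \<inter> S j = {}" using S[OF i] S[OF j(1)] j(2) g_inj[OF iI] by auto
    qed
    then show False using nolink x by blast
  qed
  have "\<forall>z\<in>K. \<exists>y\<in>K. z \<in> miss y"
    using miss_ex gf(2) by (auto simp: miss_def)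
  then obtain h where h: "\<And>z. z \<in> K \<Longrightarrow> h z \<in> K \<and> z \<in> miss (h z)"
    by metis
  have "inj_on h K" using h unique by (metis inj_onI)
  then have h_surj: "h ` K = K" using h finK by (simp add: endo_inj_surj image_subset_iff)
  \<comment> \<open>The target of \<open>x\<close> is blue to \<open>w\<close>, so \<open>x\<close> is free at the centre \<open>w\<close>.\<close>
  obtain x where x: "x \<in> K" using card(2) by fastforce
  define w where "w = h x"
  have w: "w \<in> K" "x \<in> miss w" "w \<noteq> x"
    using h[OF x] not_self by (auto simp: w_def)
  have bad_w: "i \<in> I \<and> i \<noteq> f x \<and> g i \<noteq> x" if "i \<in> bad I t w" for i
    using that w(2) fg by (auto simp: bad_def miss_def)
  show False
  proof (cases "R x (t (f w))")
    case True
    define S where "S = (\<lambda>i. if i = f w then {x} else {g i})"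
    have S: "i = f w \<and> S i = {x} \<or> S i = {g i} \<and> g i \<noteq> w \<and> g i \<noteq> x" if "i \<in> bad I t w" for i
      using bad_w[OF that] fg by (auto simp: S_def)
    have "linked X I t w"
    proof (rule link[OF w(1)])
      fix i assume i: "i \<in> bad I t w"
      note i' = bad_w[OF i]
      show "serves w (S i) (t i)" "S i \<subseteq> K - {w}"
        using S[OF i] own[of w x i] own[of w "g i" i] True w x i' fg(2) red by auto
      fix j assume j: "j \<in> bad I t w" "i \<noteq> j"
      show "S i \<inter> S j = {}"
        using S[OF i] S[OF j(1)] j(2) i' bad_w[OF j(1)] g_inj by auto
    qed
    then show False using nolink w(1) by blast
  next
    case False
    then have wx: "w \<in> miss x" using w by (simp add: miss_def)
    have "card (K - {x, w}) \<noteq> 0" using card(2) x w finK by (simp add: card_Diff_subset)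
    then obtain s where s: "s \<in> K" "s \<noteq> x" "s \<noteq> w"
      by (metis Diff_iff all_not_in_conv card.empty insert_iff)
    have Rs: "R s (t (f w))"
    proof (rule ccontr)
      assume "\<not> ?thesis"
      then have "w \<in> miss s" using w by (simp add: miss_def)
      moreover obtain a b where "a \<in> K" "h a = x" "b \<in> K" "h b = s"
        using h_surj x s(1) by (metis imageE)
      ultimately have "a = w" "b = w" using h unique wx x s(1) by metis+
      then show False using \<open>h a = x\<close> \<open>h b = s\<close> s(2) by simp
    qed
    have Rx: "R x (t (f s))"
      using unique[OF x wx, of s] s by (auto simp: miss_def)
    \<comment> \<open>The target of \<open>w\<close> takes over \<open>s\<close>, whose own target moves on to the free vertex \<open>x\<close>.\<close>
    define S where "S = (\<lambda>i. if i = f w then {s} else if i = f s then {x} else {g i})"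
    have S: "i = f w \<and> S i = {s} \<or> i = f s \<and> S i = {x} \<or> S i = {g i} \<and> g i \<noteq> w \<and> g i \<noteq> s \<and> g i \<noteq> x"
      if "i \<in> bad I t w" for i
      using bad_w[OF that] fg by (auto simp: S_def)
    have "linked X I t w"
    proof (rule link[OF w(1)])
      fix i assume i: "i \<in> bad I t w"
      note i' = bad_w[OF i]
      show "serves w (S i) (t i)" "S i \<subseteq> K - {w}"
        using S[OF i] own[of w s i] own[of w x i] own[of w "g i" i] Rs Rx w x s i' fg(2) red by auto
      fix j assume j: "j \<in> bad I t w" "i \<noteq> j"
      show "S i \<inter> S j = {}"
        using S[OF i] S[OF j(1)] j(2) s i' bad_w[OF j(1)] g_inj by auto
    qed
    then show False using nolink w(1) by blast
  qed
qed

lemma R_symD: "R x y \<Longrightarrow> R y x"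
  using R_sym by simp

lemma odd3_swap12: "odd3 x y z \<longleftrightarrow> odd3 y x z"
  unfolding odd3_def using R_sym[of x y] R_sym[of y z] R_sym[of x z] by auto

lemma odd3_swap23: "odd3 x y z \<longleftrightarrow> odd3 x z y"
  unfolding odd3_def using R_sym[of x y] R_sym[of y z] R_sym[of x z] by auto

lemma finite_bad: "finite I \<Longrightarrow> finite (bad I t x)"
  by (simp add: bad_def)

lemma bad_subset: "bad I t x \<subseteq> I"
  by (auto simp: bad_def)

section \<open>Small red cliques and odd triangles\<close>

lemma card_disjoint_bad:
  assumes "finite I" "\<And>i. i \<in> I \<Longrightarrow> \<not> (R x (t i) \<and> R y (t i))"
  shows "card (bad I t x) + card (bad I t y) \<le> card I"
proof -
  have "bad I t x \<inter> bad I t y = {}" using assms(2) by (auto simp: bad_def)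
  then have "card (bad I t x) + card (bad I t y) = card (bad I t x \<union> bad I t y)"
    using finite_bad[OF assms(1)] by (simp add: card_Un_disjoint)
  also have "\<dots> \<le> card I" using assms(1) bad_subset by (metis Un_least card_mono)
  finally show ?thesis .
qed

lemma linked_triangle_through:
  assumes "odd3 x p q" "distinct [x, p, q]" "{x, p, q} \<subseteq> X" "finite I" "card (bad I t x) \<le> 1"
  shows "linked X I t x"
proof (rule linked_universal1[where A = "{p, q}"])
  show "serves x {p, q} u" for u
    by (rule serves_triangle_through[OF assms(1)]) (use assms(2) in auto)
qed (use assms in auto)

lemma linked_two_triangles:
  assumes "odd3 x p q" "odd3 a b c" "distinct [x, p, q, a, b, c]" "{x, p, q, a, b, c} \<subseteq> X"
    and "finite I" "card (bad I t x) \<le> 2"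
  shows "linked X I t x"
proof (rule linked_universal2[where A = "{p, q}" and B = "{a, b, c}"])
  show "serves x {p, q} u" for u
    by (rule serves_triangle_through[OF assms(1)]) (use assms(3) in auto)
  show "serves x {a, b, c} u" for u
    by (rule serves_triangle[OF assms(2)]) (use assms(3) in auto)
qed (use assms in auto)

text \<open>
Used when the largest red clique is an edge: no target is red to both ends of \<open>x y\<close>, so one of the ends
has at most half of the targets as bad targets. The same idea gives the next lemma.
\<close>

lemma edge_linked_one_triangle:
  assumes "odd3 x y z" "distinct [x, y, z]" "{x, y, z} \<subseteq> X" "R x y"
    and "finite I" "card I \<le> 3" "\<And>i. i \<in> I \<Longrightarrow> \<not> (R x (t i) \<and> R y (t i))"
  shows "\<exists>v\<in>X. linked X I t v"
proof -
  have "card (bad I t x) \<le> 1 \<or> card (bad I t y) \<le> 1"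
    using card_disjoint_bad[of I x t y, OF assms(5,7)] assms(6) by linarith
  then have "linked X I t x \<or> linked X I t y"
    using linked_triangle_through[of x y z X I t] linked_triangle_through[of y x z X I t]
      odd3_swap12 assms(1-3,5) by auto
  then show ?thesis using assms(3) by auto
qed

lemma edge_linked_two_triangles:
  assumes "odd3 x y z" "odd3 a b c" "distinct [x, y, z, a, b, c]" "{x, y, z, a, b, c} \<subseteq> X" "R x y"
    and "finite I" "card I \<le> 5" "\<And>i. i \<in> I \<Longrightarrow> \<not> (R x (t i) \<and> R y (t i))"
  shows "\<exists>v\<in>X. linked X I t v"
proof -
  have "card (bad I t x) \<le> 2 \<or> card (bad I t y) \<le> 2"
    using card_disjoint_bad[of I x t y, OF assms(6,8)] assms(7) by linarith
  then have "linked X I t x \<or> linked X I t y"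
    using linked_two_triangles[of x y z a b c X I t] linked_two_triangles[of y x z a b c X I t]
      odd3_swap12 assms(1-4,6) by auto
  then show ?thesis using assms(4) by auto
qed

text \<open>
Each element of \<open>I\<close> is counted at most twice.
\<close>

lemma card_triple_sum:
  assumes "finite I" "A \<subseteq> I" "B \<subseteq> I" "C \<subseteq> I" "A \<inter> B \<inter> C = {}"
  shows "card A + card B + card C \<le> 2 * card I"
proof -
  have fin: "finite A" "finite B" "finite C" using assms finite_subset by blast+
  have "card A + card B = card (A \<union> B) + card (A \<inter> B)" using fin by (intro card_Un_Int)
  moreover have "card (A \<inter> B) + card C = card (A \<inter> B \<union> C)"
    using fin assms(5) by (simp add: card_Un_disjoint)
  moreover have "card (A \<union> B) \<le> card I" "card (A \<inter> B \<union> C) \<le> card I"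
    using assms by (auto intro!: card_mono)
  ultimately show ?thesis by linarith
qed

text \<open>
If no centre works, every vertex of the red triangle \<open>x p q\<close> has at least three bad targets, because
two could be served by the odd triangles \<open>x p q\<close> and \<open>a b c\<close>. Every target misses one vertex of \<open>x p q\<close>, so
some vertex, say \<open>x\<close>, has exactly three. The two other targets cannot account for all bad targets of \<open>p\<close>
or of \<open>q\<close>, so \<open>p\<close> and \<open>q\<close> serve two different bad targets of \<open>x\<close>, and \<open>a b c\<close> serves the third.
\<close>

lemma triangle_linked_five:
  assumes odd: "odd3 a b c" and dist: "distinct [x, p, q, a, b, c]" and X: "{x, p, q, a, b, c} \<subseteq> X"
    and red: "R x p" "R x q" "R p q"
    and fin: "finite I" and card: "card I \<le> 5"
    and free: "\<And>i. i \<in> I \<Longrightarrow> \<not> (R x (t i) \<and> R p (t i) \<and> R q (t i))"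
  shows "\<exists>v\<in>X. linked X I t v"
proof (rule ccontr)
  assume no: "\<not> ?thesis"
  \<comment> \<open>The situation is symmetric in \<open>x, p, q\<close>; here \<open>x\<close> is the vertex with three bad targets.\<close>
  have core: False
    if K: "distinct [x, p, q, a, b, c]" "{x, p, q} \<subseteq> X" "R x p" "R x q" "R p q"
      "\<And>i. i \<in> I \<Longrightarrow> \<not> (R x (t i) \<and> R p (t i) \<and> R q (t i))"
      "card (bad I t x) \<le> 3" "3 \<le> card (bad I t p)" "3 \<le> card (bad I t q)" "3 \<le> card (bad I t x)" for x p q
  proof -
    have c3: "card (bad I t x) = 3" using K by simp
    \<comment> \<open>Only two targets are not bad for \<open>x\<close>.\<close>
    have meet: "\<exists>i. i \<in> bad I t y \<and> i \<in> bad I t x" if "3 \<le> card (bad I t y)" for y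
    proof (rule ccontr)
      assume "\<not> ?thesis"
      then have "bad I t y \<inter> bad I t x = {}" by blast
      then have "card (bad I t y) + card (bad I t x) = card (bad I t y \<union> bad I t x)"
        using finite_bad[OF fin] by (simp add: card_Un_disjoint)
      also have "\<dots> \<le> card I" using fin bad_subset by (metis Un_least card_mono)
      finally show False using that c3 card by simp
    qed
    obtain i where i: "i \<in> bad I t p" "i \<in> bad I t x" using meet K(8) by blast
    obtain j where j: "j \<in> bad I t q" "j \<in> bad I t x" using meet K(9) by blast
    have "i \<noteq> j" using i j K(6) by (auto simp: bad_def)
    have "card (bad I t x - {i, j}) = 1" using i j c3 \<open>i \<noteq> j\<close> finite_bad[OF fin] by (simp add: card_Diff_subset)
    then obtain k where k: "bad I t x - {i, j} = {k}" by (auto simp: card_1_singleton_iff)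
    have "linked X I t x"
    proof (rule linked3[of x X I t i j k "{p}" "{q}" "{a, b, c}"])
      show "serves x {p} (t i)" using i K(3) by (intro serves_one[of x p]) (auto simp: bad_def)
      show "serves x {q} (t j)" using j K(4) by (intro serves_one[of x q]) (auto simp: bad_def)
      show "serves x {a, b, c} (t k)" by (rule serves_triangle[OF odd]) (use K(1) in auto)
      show "bad I t x \<subseteq> {i, j, k}" "distinct [i, j, k]" using k \<open>i \<noteq> j\<close> by auto
    qed (use K(1,2) X in auto)
    then show False using no K(2) by auto
  qed
  have red': "R p x" "R q x" "R q p" using red R_symD by blast+
  have odd_xpq: "odd3 x p q" "odd3 p x q" "odd3 q x p"
    unfolding odd3_def using red red' by simp_all
  have nolink: "\<not> linked X I t x" "\<not> linked X I t p" "\<not> linked X I t q" using no X by auto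
  have x: "3 \<le> card (bad I t x)"
  proof (rule ccontr)
    assume "\<not> ?thesis"
    then have "linked X I t x"
      by (intro linked_two_triangles[OF odd_xpq(1) odd dist X fin]) simp
    then show False using nolink by simp
  qed
  have p: "3 \<le> card (bad I t p)"
  proof (rule ccontr)
    assume "\<not> ?thesis"
    then have "linked X I t p"
      by (intro linked_two_triangles[OF odd_xpq(2) odd _ _ fin]) (use dist X in auto)
    then show False using nolink by simp
  qed
  have q: "3 \<le> card (bad I t q)"
  proof (rule ccontr)
    assume "\<not> ?thesis"
    then have "linked X I t q"
      by (intro linked_two_triangles[OF odd_xpq(3) odd _ _ fin]) (use dist X in auto)
    then show False using nolink by simp
  qed
  have "bad I t x \<inter> bad I t p \<inter> bad I t q = {}" using free by (auto simp: bad_def)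
  then have "card (bad I t x) + card (bad I t p) + card (bad I t q) \<le> 2 * card I"
    by (intro card_triple_sum[OF fin]) (simp_all add: bad_subset)
  then have "card (bad I t x) + card (bad I t p) + card (bad I t q) \<le> 10" using card by linarith
  then consider "card (bad I t x) \<le> 3" | "card (bad I t p) \<le> 3" | "card (bad I t q) \<le> 3"
    by linarith
  then show False
  proof cases
    case 1
    show False using 1 by (intro core[of x p q]) (use x p q dist X red free in auto)
  next
    case 2
    show False using 2 by (intro core[of p x q]) (use x p q dist X red red' free in auto)
  next
    case 3
    show False using 3 by (intro core[of q x p]) (use x p q dist X red red' free in auto)
  qed
qed

lemma card_four_sum:
  assumes "finite I" "A \<subseteq> I" "B \<subseteq> I" "C \<subseteq> I" "D \<subseteq> I" "A \<inter> B \<inter> C \<inter> D = {}"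
  shows "card A + card B + card C + card D \<le> 3 * card I"
proof -
  have fin: "finite A" "finite B" using assms finite_subset by blast+
  have "card A + card B = card (A \<union> B) + card (A \<inter> B)" using fin by (intro card_Un_Int)
  moreover have "card (A \<inter> B) + card C + card D \<le> 2 * card I"
    using assms by (intro card_triple_sum) auto
  moreover have "card (A \<union> B) \<le> card I" using assms by (auto intro!: card_mono)
  ultimately show ?thesis by linarith
qed

text \<open>
The configuration that finishes the case of a red \<open>K\<^sub>4\<close>: the bad targets of \<open>p\<close> are among one target \<open>k\<close>
that is bad for \<open>x\<close> and the two targets that are not. At the centre \<open>p\<close>, the target \<open>k\<close> is served by
\<open>x\<close>, and the other two are served by \<open>q\<close> and \<open>s\<close>.
\<close>

lemma four_clique_core:
  assumes "distinct [x, p, q, s]" "{x, p, q, s} \<subseteq> X" "R p x" "R p q" "R p s"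
    and "card I = 5" "card (bad I t x) = 3" "k \<in> bad I t x" "k \<in> bad I t p"
    and "finite I" "bad I t p \<inter> bad I t x \<subseteq> {k}" "I - bad I t x \<subseteq> bad I t q"
    and "(I - bad I t x) \<inter> bad I t s \<noteq> {}"
  shows "linked X I t p"
proof -
  have "card (I - bad I t x) = 2"
    using assms(6,7,10) bad_subset[of I t x] by (simp add: card_Diff_subset finite_bad)
  then obtain l m where lm: "I - bad I t x = {l, m}" "l \<noteq> m" by (auto simp: card_2_iff)
  obtain l m where lm: "I - bad I t x = {l, m}" "l \<noteq> m" "m \<in> bad I t s"
  proof -
    have "l \<in> bad I t s \<or> m \<in> bad I t s" using assms(13) lm(1) by auto
    then show ?thesis using that[of l m] that[of m l] lm by (auto simp: insert_commute)
  qed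
  have l: "l \<in> bad I t q" using assms(12) lm by auto
  have k: "k \<noteq> l" "k \<noteq> m" using assms(8) lm(1) by auto
  show ?thesis
  proof (rule linked3[of p X I t k l m "{x}" "{q}" "{s}"])
    show "bad I t p \<subseteq> {k, l, m}"
    proof
      fix i assume "i \<in> bad I t p"
      then show "i \<in> {k, l, m}" using assms(11) lm(1) bad_subset[of I t p] by blast
    qed
    show "serves p {x} (t k)" using assms(3,8) by (intro serves_one[of p x]) (auto simp: bad_def)
    show "serves p {q} (t l)" using assms(4) l by (intro serves_one[of p q]) (auto simp: bad_def)
    show "serves p {s} (t m)" using assms(5) lm(3) by (intro serves_one[of p s]) (auto simp: bad_def)
    show "distinct [k, l, m]" using k lm(2) by simp
  qed (use assms(1,2) in auto)
qed

definition exactly_one :: "bool \<Rightarrow> bool \<Rightarrow> bool \<Rightarrow> bool" where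
  "exactly_one a b c \<longleftrightarrow> a \<and> \<not> b \<and> \<not> c \<or> \<not> a \<and> b \<and> \<not> c \<or> \<not> a \<and> \<not> b \<and> c"

text \<open>
Hall's condition for three subsets of a three-element set, written out: \<open>ip\<close> says that the element
\<open>i\<close> belongs to the set \<open>p\<close>. If the sets are nonempty, cover everything and have no system of distinct
representatives, then two of them are the same singleton.
\<close>

lemma no_transversal:
  assumes "ip \<or> jp \<or> kp" "iq \<or> jq \<or> kq" "is \<or> js \<or> ks"
    and "\<not> (ip \<and> jq \<and> ks)" "\<not> (ip \<and> js \<and> kq)" "\<not> (iq \<and> jp \<and> ks)"
    and "\<not> (iq \<and> js \<and> kp)" "\<not> (is \<and> jp \<and> kq)" "\<not> (is \<and> jq \<and> kp)"
    and "ip \<or> iq \<or> is" "jp \<or> jq \<or> js" "kp \<or> kq \<or> ks"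
  shows "ip = iq \<and> jp = jq \<and> kp = kq \<and> exactly_one ip jp kp \<or>
    ip = is \<and> jp = js \<and> kp = ks \<and> exactly_one ip jp kp \<or>
    iq = is \<and> jq = js \<and> kq = ks \<and> exactly_one iq jq kq"
  using assms unfolding exactly_one_def
  by (cases ip; cases jp; cases kp; cases iq; cases jq; simp; blast?)

text \<open>
Let \<open>B\<close> be the set of the three bad targets of \<open>x\<close>. At the centre \<open>x\<close> one would like to serve
them by \<open>p\<close>, \<open>q\<close> and \<open>s\<close>. By Hall's condition this fails only if two of \<open>p, q, s\<close> are red to the same
single target of \<open>B\<close> (\<open>case_a\<close>) or a target \<open>u\<close> of \<open>B\<close> is blue to all three (\<open>case_b\<close>). As \<open>p\<close>, \<open>q\<close>, \<open>s\<close> have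
three bad targets each and only two lie outside \<open>B\<close>, in both situations one of them has the shape
required by \<open>four_clique_core\<close>; in \<open>case_b\<close> the other two targets \<open>v\<close> and \<open>w\<close> of \<open>B\<close> each miss one of
\<open>p, q, s\<close>, not the same one because each of \<open>p, q, s\<close> is red to some target of \<open>B\<close>.
\<close>

lemma four_clique_three_bad:
  assumes dist: "distinct [x, p, q, s]" and X: "{x, p, q, s} \<subseteq> X"
    and red: "red_clique {x, p, q, s}"
    and fin: "finite I" and card: "card I = 5" and cx: "card (bad I t x) = 3"
    and cp: "3 \<le> card (bad I t p)" and cq: "3 \<le> card (bad I t q)" and cs: "3 \<le> card (bad I t s)"
    and free: "\<And>i. i \<in> I \<Longrightarrow> \<not> (R x (t i) \<and> R p (t i) \<and> R q (t i) \<and> R s (t i))"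
  shows "\<exists>v\<in>X. linked X I t v"
proof (rule ccontr)
  assume no: "\<not> ?thesis"
  have nolink: "\<not> linked X I t x" "\<not> linked X I t p" "\<not> linked X I t q" "\<not> linked X I t s"
    using no X by auto
  let ?B = "bad I t x" and ?P = "bad I t p" and ?Q = "bad I t q" and ?S = "bad I t s"
  have r: "R a b" if "a \<in> {x, p, q, s}" "b \<in> {x, p, q, s}" "a \<noteq> b" for a b
    using red_cliqueD[OF red that] .
  note finb = finite_bad[OF fin]
  have co: "card (I - ?B) = 2"
    using card cx bad_subset[of I t x] finb by (simp add: card_Diff_subset)
  have meet: "A \<inter> ?B \<noteq> {}" if "3 \<le> card A" "A \<subseteq> I" for A
  proof
    assume "A \<inter> ?B = {}"
    then have "A \<subseteq> I - ?B" using that by blast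
    then have "card A \<le> 2" using co fin card_mono[of "I - ?B" A] by simp
    then show False using that by simp
  qed
  have core: False
    if "k \<in> ?B" "k \<in> bad I t a" "bad I t a \<inter> ?B \<subseteq> {k}" "I - ?B \<subseteq> bad I t b" "(I - ?B) \<inter> bad I t c \<noteq> {}"
      "{a, b, c} = {p, q, s}" "distinct [a, b, c]" for a b c k
  proof -
    have "a \<in> {p, q, s}" "b \<in> {p, q, s}" "c \<in> {p, q, s}" using that(6) by auto
    then have "linked X I t a"
      using dist X r that by (intro four_clique_core[of x a b c X I t k]) (auto simp: card cx fin)
    then show False using nolink \<open>a \<in> {p, q, s}\<close> by auto
  qed
  have singleton_covers: "I - ?B \<subseteq> A" if "3 \<le> card A" "A \<subseteq> I" "A \<inter> ?B \<subseteq> {k}" for A k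
  proof -
    have fA: "finite A" using that fin finite_subset by blast
    have "card A = card (A - ?B) + card (A \<inter> ?B)"
      using fA by (metis card_Diff_subset_Int finite_Int card_mono inf_le1 le_add_diff_inverse2)
    moreover have "card (A \<inter> ?B) \<le> 1" using card_mono[OF _ that(3)] by simp
    ultimately have "2 \<le> card (A - ?B)" using that by linarith
    then have "A - ?B = I - ?B" using co fin that(2) by (intro card_seteq) auto
    then show ?thesis by blast
  qed
  have meets_rest: "(I - ?B) \<inter> A \<noteq> {}" if "3 \<le> card A" "A \<subseteq> I" "\<not> ?B \<subseteq> A" for A
  proof
    assume "(I - ?B) \<inter> A = {}"
    then have "A \<subset> ?B" using that by blast
    then have "card A < card ?B" using finb psubset_card_mono by blast
    then show False using that cx by simp
  qed
  have three: "3 \<le> card (bad I t a)" if "a \<in> {p, q, s}" for a using that cp cq cs by auto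
  have case_a: False
    if k: "k \<in> ?B" "bad I t a \<inter> ?B = {k}" "bad I t b \<inter> ?B = {k}"
      and abc: "{a, b, c} = {p, q, s}" "distinct [a, b, c]" for a b c k
  proof -
    have abc': "a \<in> {p, q, s}" "b \<in> {p, q, s}" "c \<in> {p, q, s}" using abc(1) by auto
    have "R a (t k)" "R b (t k)" "R x (t k)" "k \<in> I" using k by (auto simp: bad_def)
    then have "\<not> R c (t k)" using free[of k] abc by auto
    then have "\<not> ?B \<subseteq> bad I t c" using k(1) by (auto simp: bad_def)
    then have "(I - ?B) \<inter> bad I t c \<noteq> {}" using meets_rest[OF three[OF abc'(3)] bad_subset] by blast
    moreover have "I - ?B \<subseteq> bad I t b" using singleton_covers[OF three[OF abc'(2)] bad_subset] k by blast
    ultimately show False using core[of k a b c] k abc by blast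
  qed
  obtain i j k where B: "?B = {i, j, k}" and ijk: "distinct [i, j, k]"
    using cx by (auto simp: card_3_iff)
  \<comment> \<open>Otherwise \<open>p, q, s\<close> serve the three bad targets of \<open>x\<close>.\<close>
  have notrans: "\<not> (R p (t a) \<and> R q (t b) \<and> R s (t c))" if "{a, b, c} = {i, j, k}" "distinct [a, b, c]" for a b c
  proof
    assume abc: "R p (t a) \<and> R q (t b) \<and> R s (t c)"
    have "linked X I t x"
    proof (rule linked3[of x X I t a b c "{p}" "{q}" "{s}"])
      show "serves x {p} (t a)" using abc r dist by (intro serves_one[of x p]) auto
      show "serves x {q} (t b)" using abc r dist by (intro serves_one[of x q]) auto
      show "serves x {s} (t c)" using abc r dist by (intro serves_one[of x s]) auto
    qed (use dist X B that in auto)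
    then show False using nolink by simp
  qed
  have case_b: False
    if u: "{u, v, w} = {i, j, k}" "distinct [u, v, w]" "\<not> R p (t u)" "\<not> R q (t u)" "\<not> R s (t u)" for u v w
  proof -
    have B': "?B = {u, v, w}" using B u by simp
    have uB: "u \<in> ?B" using B' by simp
    have rest: "(I - ?B) \<inter> bad I t a \<noteq> {}" if "a \<in> {p, q, s}" for a
      using meets_rest[OF three[OF that] bad_subset] uB u(3-5) that by (auto simp: bad_def)
    have vw: "\<exists>a\<in>{p, q, s}. \<not> R a (t n)" if "n \<in> {v, w}" for n
    proof -
      have "n \<in> ?B" using that B' by auto
      then show ?thesis using free[of n] by (auto simp: bad_def)
    qed
    have fin_core: False
      if ab: "a \<in> {p, q, s}" "b \<in> {p, q, s}" "a \<noteq> b" and "\<not> R a (t v)" "\<not> R b (t w)" for a b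
    proof -
      have a: "bad I t a \<inter> ?B \<subseteq> {w}" and b: "bad I t b \<inter> ?B \<subseteq> {v}"
        using B' u(3-5) that by (auto simp: bad_def)
      have "w \<in> bad I t a"
        using a meet[OF three[OF ab(1)] bad_subset] by auto
      moreover have "I - ?B \<subseteq> bad I t b" using singleton_covers[OF three[OF ab(2)] bad_subset b] .
      moreover obtain c where "{a, b, c} = {p, q, s}" "distinct [a, b, c]"
      proof -
        have "card ({p, q, s} - {a, b}) = 1" using ab dist by (auto simp: card_insert_if)
        then obtain c where "{p, q, s} - {a, b} = {c}" by (auto simp: card_1_singleton_iff)
        then show ?thesis using that[of c] ab by auto
      qed
      moreover have "w \<in> ?B" using B' by simp
      moreover have "c \<in> {p, q, s}" using calculation by auto
      ultimately show False using core[of w a b c] a rest[of c] by blast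
    qed
    obtain a b where ab: "a \<in> {p, q, s}" "\<not> R a (t v)" "b \<in> {p, q, s}" "\<not> R b (t w)"
      using vw[of v] vw[of w] by blast
    show False
    proof (cases "a = b")
      case False
      then show False using fin_core ab by blast
    next
      case True
      then have "bad I t a \<inter> ?B = {}" using ab u(3-5) B' by (auto simp: bad_def)
      then show False using meet[OF three[OF ab(1)] bad_subset] by blast
    qed
  qed
  have ex: "R a (t i) \<or> R a (t j) \<or> R a (t k)" if "a \<in> {p, q, s}" for a
    using meet[OF three[OF that] bad_subset] B by (auto simp: bad_def)
  have ci: "R p (t i) \<or> R q (t i) \<or> R s (t i)" using case_b[of i j k] ijk by auto
  have cj: "R p (t j) \<or> R q (t j) \<or> R s (t j)" using case_b[of j i k] ijk by auto
  have ck: "R p (t k) \<or> R q (t k) \<or> R s (t k)" using case_b[of k i j] ijk by auto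
  have I: "i \<in> I" "j \<in> I" "k \<in> I" using B bad_subset[of I t x] by auto
  have same: False
    if "R a (t i) = R b (t i)" "R a (t j) = R b (t j)" "R a (t k) = R b (t k)"
      "exactly_one (R a (t i)) (R a (t j)) (R a (t k))"
      "{a, b, c} = {p, q, s}" "distinct [a, b, c]" for a b c
  proof -
    have eq: "bad I t a \<inter> ?B = bad I t b \<inter> ?B" using that(1-3) B by (auto simp: bad_def)
    have "\<exists>n\<in>?B. bad I t a \<inter> ?B = {n}"
      using that(4) B I unfolding exactly_one_def by (auto simp: bad_def)
    then show False using case_a[of _ a b c] eq that(5,6) by auto
  qed
  have "R p (t i) = R q (t i) \<and> R p (t j) = R q (t j) \<and> R p (t k) = R q (t k)
      \<and> exactly_one (R p (t i)) (R p (t j)) (R p (t k)) \<or>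
    R p (t i) = R s (t i) \<and> R p (t j) = R s (t j) \<and> R p (t k) = R s (t k)
      \<and> exactly_one (R p (t i)) (R p (t j)) (R p (t k)) \<or>
    R q (t i) = R s (t i) \<and> R q (t j) = R s (t j) \<and> R q (t k) = R s (t k)
      \<and> exactly_one (R q (t i)) (R q (t j)) (R q (t k))"
    by (rule no_transversal)
      (use ex ci cj ck notrans[of i j k] notrans[of i k j] notrans[of j i k] notrans[of k i j]
        notrans[of j k i] notrans[of k j i] ijk in auto)
  moreover have "distinct [p, q, s]" "distinct [p, s, q]" "distinct [q, s, p]" "{p, s, q} = {p, q, s}" "{q, s, p} = {p, q, s}"
    using dist by auto
  ultimately show False
    using same[of p q s] same[of p s q] same[of q s p] by blast
qed

text \<open>
The odd triangle \<open>v a b\<close> and the other three vertices of \<open>K\<close> are disjoint odd triangles, so two bad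
targets can be served at any centre in \<open>K\<close>, and if no centre works there are at least three at each. Since
every target misses a vertex of \<open>K\<close>, some centre has at most three, and \<open>four_clique_three_bad\<close> applies.
\<close>

lemma four_clique_linked:
  assumes clique: "red_clique K" "card K = 4" and v: "v \<in> K" "odd3 v a b"
    and X: "K \<union> {a, b} \<subseteq> X" "a \<notin> K" "b \<notin> K" "a \<noteq> b"
    and fin: "finite I" and card: "card I = 5"
    and free: "\<And>i. i \<in> I \<Longrightarrow> \<exists>y\<in>K. \<not> R y (t i)"
  shows "\<exists>x\<in>X. linked X I t x"
proof (rule ccontr)
  assume no: "\<not> ?thesis"
  have finK: "finite K" using clique(2) by (metis card.infinite zero_neq_numeral)
  have r: "R x y" if "x \<in> K" "y \<in> K" "x \<noteq> y" for x y
    using red_cliqueD[OF clique(1) that] .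
  have outside: "n \<noteq> a" "a \<noteq> n" "n \<noteq> b" "b \<noteq> n" if "n \<in> K" for n
    using that X(2,3) by blast+
  \<comment> \<open>\<open>v a b\<close> and the rest of \<open>K\<close> serve two targets, whether or not the centre is \<open>v\<close>.\<close>
  have ge3: "3 \<le> card (bad I t y)" if y: "y \<in> K" for y
  proof (rule ccontr)
    assume "\<not> ?thesis"
    then have le: "card (bad I t y) \<le> 2" by simp
    have "linked X I t y"
    proof (cases "y = v")
      case True
      have "card (K - {v}) = 3" using finK clique(2) v by simp
      then obtain p q s where K: "K - {v} = {p, q, s}" "p \<noteq> q" "p \<noteq> s" "q \<noteq> s" by (auto simp: card_3_iff)
      have mem: "p \<in> K" "q \<in> K" "s \<in> K" and ne: "v \<noteq> p" "v \<noteq> q" "v \<noteq> s" using K(1) by auto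
      have odd: "odd3 p q s" unfolding odd3_def using r mem K(2-4) by simp
      have "distinct [v, a, b, p, q, s]"
        using ne K(2-4) outside[OF mem(1)] outside[OF mem(2)] outside[OF mem(3)] outside[OF v(1)] X(4)
        by simp
      moreover have "{v, a, b, p, q, s} \<subseteq> X" using mem v(1) X(1) by blast
      ultimately show ?thesis
        using linked_two_triangles[OF v(2) odd _ _ fin] le True by simp
    next
      case False
      have "card (K - {v, y}) = 2" using finK clique(2) v y False by (simp add: card_Diff_subset)
      then obtain p q where K: "K - {v, y} = {p, q}" "p \<noteq> q" by (auto simp: card_2_iff)
      have pq: "p \<in> K" "q \<in> K" "v \<noteq> p" "v \<noteq> q" "y \<noteq> p" "y \<noteq> q" using K(1) by auto
      then have odd: "odd3 y p q" unfolding odd3_def using r K(2) y by simp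
      have "distinct [y, p, q, v, a, b]"
        using pq K(2) outside[OF pq(1)] outside[OF pq(2)] outside[OF y] outside[OF v(1)] X(4) False
        by simp
      moreover have "{y, p, q, v, a, b} \<subseteq> X" using pq(1,2) y v(1) X(1) by blast
      ultimately show ?thesis
        using linked_two_triangles[OF odd v(2) _ _ fin] le by simp
    qed
    then show False using no X y by auto
  qed
  have "\<exists>x\<in>K. card (bad I t x) \<le> 3"
  proof (rule ccontr)
    assume "\<not> ?thesis"
    then have ge4: "\<forall>x\<in>K. 3 < card (bad I t x)" by (simp add: not_le)
    have "card (K - {v}) = 3" using finK clique(2) v by simp
    then obtain p q s where K: "K - {v} = {p, q, s}" by (auto simp: card_3_iff)
    then have K': "K = {v, p, q, s}" using v(1) by auto
    have "bad I t v \<inter> bad I t p \<inter> bad I t q \<inter> bad I t s = {}"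
      using free K' by (auto simp: bad_def)
    then have "card (bad I t v) + card (bad I t p) + card (bad I t q) + card (bad I t s) \<le> 3 * card I"
      by (intro card_four_sum[OF fin]) (simp_all add: bad_subset)
    moreover have "3 < card (bad I t v)" "3 < card (bad I t p)" "3 < card (bad I t q)" "3 < card (bad I t s)"
      using ge4 K' by simp_all
    ultimately show False using card by linarith
  qed
  then obtain x where x: "x \<in> K" "card (bad I t x) \<le> 3" by blast
  have "card (K - {x}) = 3" using finK clique(2) x by simp
  then obtain p q s where K: "K - {x} = {p, q, s}" "p \<noteq> q" "p \<noteq> s" "q \<noteq> s" by (auto simp: card_3_iff)
  then have K': "K = {x, p, q, s}" "distinct [x, p, q, s]" using x(1) by auto
  have "\<exists>v\<in>X. linked X I t v"
  proof (rule four_clique_three_bad[OF K'(2)])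
    show "red_clique {x, p, q, s}" using clique(1) K'(1) by simp
    show "card (bad I t x) = 3" using x ge3[of x] by simp
    show "\<not> (R x (t i) \<and> R p (t i) \<and> R q (t i) \<and> R s (t i))" if "i \<in> I" for i
      using free[OF that] K'(1) by auto
  qed (use fin card ge3 K' X in auto)
  then show False using no by blast
qed

text \<open>
Suppose that no centre works. The ends of a red edge have disjoint sets of bad targets. As two bad targets
at \<open>z\<close> could be served by \<open>p q\<close> and \<open>a b\<close>, and one bad target could be served at any of the five vertices,
\<open>z\<close> has at least three bad targets and hence no red edge to \<open>p, q, a, b\<close>. Then \<open>p q\<close> and \<open>a b\<close> are red, and each
target is red to exactly one of \<open>p, q\<close> and of \<open>a, b\<close>. At the centre \<open>z\<close> a target is served by the
vertices that are blue to it, and this bipartite graph is 2-regular, so it has a perfect matching.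
\<close>

lemma edge_linked_four:
  assumes odd: "odd3 z p q" "odd3 z a b" and dist: "distinct [z, p, q, a, b]"
    and X: "{z, p, q, a, b} \<subseteq> X" and fin: "finite I" and card: "card I = 4"
    and free: "\<And>x y i. x \<in> X \<Longrightarrow> y \<in> X \<Longrightarrow> R x y \<Longrightarrow> x \<noteq> y \<Longrightarrow> i \<in> I \<Longrightarrow> \<not> (R x (t i) \<and> R y (t i))"
  shows "\<exists>x\<in>X. linked X I t x"
proof (rule ccontr)
  assume no: "\<not> ?thesis"
  have nolink: "\<not> linked X I t x" if "x \<in> X" for x using no that by blast
  have ge2: "2 \<le> card (bad I t x)" if "odd3 x y w" "distinct [x, y, w]" "{x, y, w} \<subseteq> X" for x y w
    using linked_triangle_through[OF that fin, of t] nolink[of x] that(3) by (cases "card (bad I t x) \<le> 1") auto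
  have perm: "odd3 p z q" "odd3 q z p" "odd3 a z b" "odd3 b z a"
    using odd odd3_swap12 odd3_swap23 by blast+
  have ge: "2 \<le> card (bad I t p)" "2 \<le> card (bad I t q)" "2 \<le> card (bad I t a)" "2 \<le> card (bad I t b)"
    using ge2[OF perm(1)] ge2[OF perm(2)] ge2[OF perm(3)] ge2[OF perm(4)] dist X by auto
  have z3: "3 \<le> card (bad I t z)"
  proof (rule ccontr)
    assume "\<not> ?thesis"
    then have "linked X I t z"
    proof (intro linked_universal2[where A = "{p, q}" and B = "{a, b}"])
      show "serves z {p, q} u" for u by (rule serves_triangle_through[OF odd(1)]) (use dist in auto)
      show "serves z {a, b} u" for u by (rule serves_triangle_through[OF odd(2)]) (use dist in auto)
    qed (use X dist fin in auto)
    then show False using nolink X by auto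
  qed
  have z: "\<not> R z y" if "y \<in> {p, q, a, b}" for y
  proof
    assume "R z y"
    then have "card (bad I t z) + card (bad I t y) \<le> 4"
      using card_disjoint_bad[of I z t y, OF fin] free[of z y] that X dist card by auto
    then show False using z3 ge that by auto
  qed
  have "R p q" "R a b" using odd z unfolding odd3_def by auto
  have disj: "\<not> (R p (t i) \<and> R q (t i))" "\<not> (R a (t i) \<and> R b (t i))" if "i \<in> I" for i
    using free[of p q i] free[of a b i] \<open>R p q\<close> \<open>R a b\<close> that X dist by auto
  have cards: "card (bad I t p) = 2" "card (bad I t q) = 2" "card (bad I t a) = 2" "card (bad I t b) = 2"
    using card_disjoint_bad[of I p t q, OF fin disj(1)] card_disjoint_bad[of I a t b, OF fin disj(2)] ge card by auto
  have un: "bad I t p \<union> bad I t q = I"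
  proof (rule card_subset_eq[OF fin])
    have "bad I t p \<inter> bad I t q = {}" using disj(1) by (auto simp: bad_def)
    then show "card (bad I t p \<union> bad I t q) = card I"
      using cards card finite_bad[OF fin] by (simp add: card_Un_disjoint)
  qed (auto simp: bad_def)
  \<comment> \<open>\<open>j\<close> and \<open>l\<close> will use different vertices of \<open>a, b\<close>.\<close>
  have "\<exists>j l. j \<in> bad I t p \<and> l \<in> bad I t q \<and> R a (t j) \<noteq> R a (t l)"
  proof (rule ccontr)
    assume n: "\<not> ?thesis"
    obtain i0 where i0: "i0 \<in> bad I t p" using cards(1) by (metis card.empty ex_in_conv zero_neq_numeral)
    obtain l0 where l0: "l0 \<in> bad I t q" using cards(2) by (metis card.empty ex_in_conv zero_neq_numeral)
    have eq: "R a (t j) = R a (t l)" if "j \<in> bad I t p" "l \<in> bad I t q" for j l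
      using n that by blast
    have "R a (t i) = R a (t l0)" if "i \<in> I" for i
      using eq[of i l0] eq[of i0 i] eq[of i0 l0] i0 l0 that un by auto
    then have "bad I t a = I \<or> bad I t a = {}" by (auto simp: bad_def)
    then show False using cards(3) card by auto
  qed
  then obtain j l where jl: "j \<in> bad I t p" "l \<in> bad I t q" "R a (t j) \<noteq> R a (t l)" by blast
  have fb: "finite (bad I t p)" "finite (bad I t q)" using finite_bad[OF fin] by auto
  have "card (bad I t p - {j}) = 1" "card (bad I t q - {l}) = 1" using cards jl fb by simp_all
  then obtain i k where ik: "bad I t p - {j} = {i}" "bad I t q - {l} = {k}" by (auto simp: card_1_singleton_iff)
  have mem: "i \<in> I" "j \<in> I" "k \<in> I" "l \<in> I" "R p (t i)" "R p (t j)" "R q (t k)" "R q (t l)" "i \<noteq> j" "k \<noteq> l"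
    using ik jl(1,2) by (auto simp: bad_def)
  have nR: "\<not> R q (t i)" "\<not> R q (t j)" "\<not> R p (t k)" "\<not> R p (t l)"
    using disj(1) mem by blast+
  have ne: "i \<noteq> k" "i \<noteq> l" "j \<noteq> k" "j \<noteq> l" using nR mem by auto
  have "linked X I t z"
  proof (rule linked4[of z X I t i j k l "{q}" "if R a (t j) then {b} else {a}" "{p}" "if R a (t l) then {b} else {a}"])
    have "bad I t z \<subseteq> bad I t p \<union> bad I t q" using un bad_subset[of I t z] by simp
    then show "bad I t z \<subseteq> {i, j, k, l}" using ik by blast
    show "serves z {q} (t i)" using z nR by (intro serves_one[of z q]) auto
    show "serves z {p} (t k)" using z nR by (intro serves_one[of z p]) auto
    have "serves z (if R a (t n) then {b} else {a}) (t n)" if "n \<in> I" for n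
      using z disj(2)[OF that] serves_one[of z a] serves_one[of z b] by auto
    then show "serves z (if R a (t j) then {b} else {a}) (t j)" "serves z (if R a (t l) then {b} else {a}) (t l)"
      using mem by blast+
  qed (use X dist mem ne jl(3) in auto)
  then show False using nolink X by auto
qed

text \<open>
The vertex \<open>y\<close> has the two bad targets \<open>i\<close> and \<open>j\<close>, and only \<open>p\<close> in the red triangle serves them.
The second one could be served by an odd triangle in \<open>{y, q, a, b}\<close> or by \<open>a\<close> or \<open>b\<close> alone. If all
this fails, then \<open>p a b\<close> is odd, and the centre \<open>p\<close> works: \<open>i\<close> uses \<open>y\<close>, one of \<open>k, l\<close>
uses \<open>q\<close>, and \<open>a\<close>, \<open>b\<close> serve the others. If all four targets are bad at \<open>p\<close>, this also needs that \<open>k\<close>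
and \<open>l\<close> cannot be served at the centre \<open>q\<close>; then the parities force one of \<open>a, b\<close> to serve \<open>j\<close> and the other \<open>l\<close>.
\<close>

lemma triangle_linked_four_twins:
  assumes dist: "distinct [y, p, q, a, b]" and X: "{y, p, q, a, b} \<subseteq> X"
    and red: "R y p" "R y q" "R p q" and odd: "odd3 y a b \<or> odd3 p a b \<or> odd3 q a b"
    and I: "distinct [i, j, k, l]" "I = {i, j, k, l}"
    and y: "R y (t i)" "R y (t j)" "\<not> R y (t k)" "\<not> R y (t l)"
    and p: "R p (t i)" "R p (t j)"
    and q: "\<not> R q (t i)" "\<not> R q (t j)" "R q (t k)" "R q (t l)"
  shows "\<exists>v\<in>X. linked X I t v"
proof (rule ccontr)
  assume no: "\<not> ?thesis"
  have nolink: "\<not> linked X I t y" "\<not> linked X I t p" "\<not> linked X I t q" using no X by auto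
  have rs: "R p y" "R q y" "R q p" using red R_symD by blast+
  have bad_y: "bad I t y \<subseteq> {i, j}" and bad_q: "bad I t q \<subseteq> {k, l}"
    using y q I(2) by (auto simp: bad_def)
  have sy: "serves y {p} (t i)" "serves y {p} (t j)"
    using red p by (auto intro: serves_one[of y p])
  \<comment> \<open>The target \<open>n\<close> would use \<open>{q, a, b}\<close> and its twin would use \<open>p\<close>.\<close>
  have even_y: "\<not> serves y {q, a, b} (t n)" if "n = i \<or> n = j" for n
  proof
    assume s: "serves y {q, a, b} (t n)"
    have "linked X I t y"
    proof (cases "n = i")
      case True
      show ?thesis
        by (rule linked2[of y X I t i j "{q, a, b}" "{p}"]) (use s True sy bad_y dist X in auto)
    next
      case False
      then have "n = j" using that by simp
      show ?thesis
        by (rule linked2[of y X I t i j "{p}" "{q, a, b}"]) (use s \<open>n = j\<close> sy bad_y dist X in auto)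
    qed
    then show False using nolink by simp
  qed
  have tri: "\<not> odd3 y q a" "\<not> odd3 y q b" "\<not> odd3 y a b" "\<not> odd3 q a b"
    using even_y[of i] serves_triangle_through[of y q a "{q, a, b}" "t i"]
      serves_triangle_through[of y q b "{q, a, b}" "t i"]
      serves_triangle_through[of y a b "{q, a, b}" "t i"]
      serves_triangle[of q a b "{q, a, b}" y "t i"] dist by auto
  then have pab: "odd3 p a b" using odd by blast
  have one_y: "R y a \<noteq> R a (t j)" "R y b \<noteq> R b (t j)"
    using even_y[of j] serves_one[of y a "t j" "{q, a, b}"] serves_one[of y b "t j" "{q, a, b}"] by auto
  have spy: "serves p {y} (t i)" using rs y by (auto intro: serves_one[of p y])
  have bad_p: "bad I t p \<subseteq> {i, j, k, l}" using I(2) by (auto simp: bad_def)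
  have sj: "serves p {a, b} (t j)"
    using serves_triangle_through[OF pab, of "{a, b}"] dist by simp
  have sq: "serves p {q} (t k)" "serves p {q} (t l)" using red q by (auto intro: serves_one[of p q])
  consider "\<not> R p (t k)" "\<not> R p (t l)" | "R p (t k)" "\<not> R p (t l)" | "\<not> R p (t k)" "R p (t l)"
    | "R p (t k)" "R p (t l)" by blast
  then show False
  proof cases
    case 1
    then have "bad I t p \<subseteq> {i, j}" using bad_p by (auto simp: bad_def)
    then have "linked X I t p"
      by (rule linked2[of p X I t i j "{y}" "{a, b}", rotated]) (use spy sj dist X in auto)
    then show False using nolink by simp
  next
    case 2
    then have "bad I t p \<subseteq> {i, j, k}" using bad_p by (auto simp: bad_def)
    then have "linked X I t p"
      by (rule linked3[of p X I t i j k "{y}" "{a, b}" "{q}", rotated]) (use spy sj sq dist X I(1) in auto)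
    then show False using nolink by simp
  next
    case 3
    then have "bad I t p \<subseteq> {i, j, l}" using bad_p by (auto simp: bad_def)
    then have "linked X I t p"
      by (rule linked3[of p X I t i j l "{y}" "{a, b}" "{q}", rotated]) (use spy sj sq dist X I(1) in auto)
    then show False using nolink by simp
  next
    case 4
    have sqk: "serves q {p} (t k)" using rs 4 by (auto intro: serves_one[of q p])
    have one_q: "R q w \<noteq> R w (t l)" if w: "w \<in> {a, b}" for w
    proof
      assume eq: "R q w = R w (t l)"
      have "linked X I t q"
        by (rule linked2[of q X I t k l "{p}" "{w}"])
          (use sqk bad_q dist X w eq in \<open>auto intro: serves_one[of q w]\<close>)
      then show False using nolink by simp
    qed
    have "R p a = R a (t j) \<and> R p b = R b (t l) \<or> R p b = R b (t j) \<and> R p a = R a (t l)"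
      using one_y one_q[of a] one_q[of b] tri pab red R_sym unfolding odd3_def by auto
    then obtain w w' where w: "{w, w'} = {a, b}" "w \<noteq> w'" "R p w = R w (t j)" "R p w' = R w' (t l)"
      using dist by (metis distinct_length_2_or_more insert_commute)
    have "linked X I t p"
      by (rule linked4[OF _ bad_p I(1), of X "{y}" "{w}" "{q}" "{w'}"])
        (use spy sq w dist X in \<open>auto intro: serves_one[of p w] serves_one[of p w'] simp: doubleton_eq_iff\<close>)
    then show False using nolink by simp
  qed
qed

text \<open>
The bad targets \<open>i, j\<close> of \<open>y\<close> cannot be served by \<open>p\<close> and \<open>q\<close> separately. So both are red to the
same one of \<open>p, q\<close> (\<open>twins\<close>), or one of them is red to neither (\<open>lone\<close>). In the second situation the
targets \<open>k, l\<close> take over the role of the twins, unless the triangle alone suffices.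
\<close>

lemma triangle_linked_four_two_bad:
  assumes dist: "distinct [y, p, q, a, b]" and X: "{y, p, q, a, b} \<subseteq> X"
    and red: "R y p" "R y q" "R p q" and odd: "odd3 y a b \<or> odd3 p a b \<or> odd3 q a b"
    and I: "distinct [i, j, k, l]" "I = {i, j, k, l}"
    and y: "R y (t i)" "R y (t j)" "\<not> R y (t k)" "\<not> R y (t l)"
    and free: "\<And>n. n \<in> I \<Longrightarrow> \<not> (R y (t n) \<and> R p (t n) \<and> R q (t n))"
    and two: "2 \<le> card (bad I t p)" "2 \<le> card (bad I t q)"
  shows "\<exists>v\<in>X. linked X I t v"
proof (rule ccontr)
  assume no: "\<not> ?thesis"
  have nolink: "\<not> linked X I t y" "\<not> linked X I t p" "\<not> linked X I t q" using no X by auto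
  have rs: "R p y" "R q y" "R q p" using red R_symD by blast+
  have finI: "finite I" using I(2) by simp
  have bad_y: "bad I t y = {i, j}" using y I(2) by (auto simp: bad_def)
  have pq: "\<not> (R p (t i) \<and> R q (t j))"
  proof
    assume "R p (t i) \<and> R q (t j)"
    then have "linked X I t y"
      by (intro linked2[of y X I t i j "{p}" "{q}"])
        (use red bad_y dist X in \<open>auto intro: serves_one[of y p] serves_one[of y q]\<close>)
    then show False using nolink by simp
  qed
  have qp: "\<not> (R q (t i) \<and> R p (t j))"
  proof
    assume "R q (t i) \<and> R p (t j)"
    then have "linked X I t y"
      by (intro linked2[of y X I t i j "{q}" "{p}"])
        (use red bad_y dist X in \<open>auto intro: serves_one[of y p] serves_one[of y q]\<close>)
    then show False using nolink by simp
  qed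
  have only: "R z (t k) \<and> R z (t l)" if "2 \<le> card (bad I t z)" "\<not> R z (t i)" "\<not> R z (t j)" for z
  proof (rule ccontr)
    assume "\<not> ?thesis"
    then have "bad I t z \<subseteq> {l} \<or> bad I t z \<subseteq> {k}" using that(2,3) I(2) by (auto simp: bad_def)
    then obtain n where "bad I t z \<subseteq> {n}" by blast
    then have "card (bad I t z) \<le> 1" using card_mono[of "{n}"] by fastforce
    then show False using that by simp
  qed
  have twins: False
    if "R p' (t i)" "R p' (t j)" "{p', q'} = {p, q}" "p' \<noteq> q'" for p' q'
  proof -
    have "p' = p \<and> q' = q \<or> p' = q \<and> q' = p" using that(3,4) by (auto simp: doubleton_eq_iff)
    then have "\<not> R q' (t i)" "\<not> R q' (t j)" "2 \<le> card (bad I t q')"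
      using that(1,2) free[of i] free[of j] y I(2) two by auto
    moreover from this have "R q' (t k)" "R q' (t l)" using only by blast+
    moreover have "distinct [y, p', q', a, b]" "{y, p', q', a, b} \<subseteq> X" "R y p'" "R y q'" "R p' q'"
      "odd3 y a b \<or> odd3 p' a b \<or> odd3 q' a b"
      using \<open>p' = p \<and> q' = q \<or> p' = q \<and> q' = p\<close> dist X red rs odd by auto
    ultimately show False
      using triangle_linked_four_twins[of y p' q' a b X i j k l I t] I y that(1,2) no by blast
  qed
  have lone: False
    if u: "{u, v} = {i, j}" "u \<noteq> v" "\<not> R p (t u)" "\<not> R q (t u)" "\<not> R q' (t v)" "{p', q'} = {p, q}" "p' \<noteq> q'"
    for u v p' q'
  proof -
    have pq': "p' = p \<and> q' = q \<or> p' = q \<and> q' = p" using u by (auto simp: doubleton_eq_iff)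
    have uv: "u = i \<and> v = j \<or> u = j \<and> v = i" using u by (auto simp: doubleton_eq_iff)
    have q': "R q' (t k)" "R q' (t l)" "\<not> R q' (t u)" using only[of q'] pq' uv two u by auto
    show False
    proof (cases "R p' (t k) \<and> R p' (t l)")
      case True
      have "\<exists>v\<in>X. linked X I t v"
        by (rule triangle_linked_four_twins[of q' p' y a b X k l i j I t])
          (use True q' uv pq' u y dist X red rs odd I in \<open>auto simp: insert_commute\<close>)
      then show False using no by blast
    next
      case False
      have pu: "\<not> R p' (t u)" using pq' u by auto
      have "bad I t p' \<subseteq> {v, l} \<or> bad I t p' \<subseteq> {v, k}"
        using False pu uv I(2) by (auto simp: bad_def)
      then obtain n where n: "n = k \<or> n = l" "bad I t p' \<subseteq> {v, n}" by blast
      have "2 \<le> card (bad I t p')" using pq' two by auto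
      moreover have "card {v, n} \<le> 2" by (simp add: card_insert_if)
      ultimately have "bad I t p' = {v, n}" using n(2) by (intro card_seteq) auto
      then have "R p' (t v)" by (auto simp: bad_def)
      have "R p' y" "R y (t v)" "R p' q'" "R q' (t n)"
        using pq' uv y red rs q' n(1) by auto
      then have "serves p' {y} (t v)" "serves p' {q'} (t n)"
        by (auto intro: serves_one[of p' y] serves_one[of p' q'])
      moreover have "p' \<in> X" "{y} \<union> {q'} \<subseteq> X - {p'}" "{y} \<inter> {q'} = {}"
        using pq' dist X by auto
      ultimately have "linked X I t p'"
        using linked2[OF _ n(2)] by blast
      then show False using nolink pq' by auto
    qed
  qed
  have ij: "i \<noteq> j" "p \<noteq> q" using I dist by auto
  have fi: "\<not> (R p (t i) \<and> R q (t i))" "\<not> (R p (t j) \<and> R q (t j))" using free[of i] free[of j] y I(2) by auto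
  consider "R p (t i)" "R p (t j)" | "R q (t i)" "R q (t j)" | "\<not> R p (t i)" "\<not> R q (t i)" | "\<not> R p (t j)" "\<not> R q (t j)"
    using pq qp fi by blast
  then show False
  proof cases
    case 1 then show False using twins[of p q] ij by blast
  next
    case 2 then show False using twins[of q p] ij by blast
  next
    case 3
    then show False using lone[of i j q p] lone[of i j p q] ij fi by blast
  next
    case 4
    then show False using lone[of j i q p] lone[of j i p q] ij fi by blast
  qed
qed

text \<open>
Each target misses a vertex of the triangle, so some vertex of the triangle has at most two bad targets.
\<close>

lemma triangle_linked_four:
  assumes dist: "distinct [y, p, q, a, b]" and X: "{y, p, q, a, b} \<subseteq> X"
    and red: "R y p" "R y q" "R p q" and odd: "odd3 y a b \<or> odd3 p a b \<or> odd3 q a b"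
    and fin: "finite I" and card: "card I = 4"
    and free: "\<And>n. n \<in> I \<Longrightarrow> \<not> (R y (t n) \<and> R p (t n) \<and> R q (t n))"
  shows "\<exists>v\<in>X. linked X I t v"
proof (rule ccontr)
  assume no: "\<not> ?thesis"
  have nolink: "\<not> linked X I t y" "\<not> linked X I t p" "\<not> linked X I t q" using no X by auto
  have rs: "R p y" "R q y" "R q p" using red R_symD by blast+
  have tri: "odd3 y p q" "odd3 p y q" "odd3 q y p" unfolding odd3_def using red rs by simp_all
  have le: "card (bad I t x) \<le> 1 \<Longrightarrow> linked X I t x" if "odd3 x v w" "distinct [x, v, w]" "{x, v, w} \<subseteq> X" for x v w
    using linked_triangle_through[OF that fin] .
  have "\<not> card (bad I t y) \<le> 1" "\<not> card (bad I t p) \<le> 1" "\<not> card (bad I t q) \<le> 1"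
    using le[OF tri(1)] le[OF tri(2)] le[OF tri(3)] nolink dist X by auto
  then have ge2: "2 \<le> card (bad I t y)" "2 \<le> card (bad I t p)" "2 \<le> card (bad I t q)"
    by simp_all
  have core: False
    if c: "card (bad I t y) \<le> 2" "2 \<le> card (bad I t y)" "distinct [y, p, q, a, b]" "{y, p, q, a, b} \<subseteq> X"
      "R y p" "R y q" "R p q" "odd3 y a b \<or> odd3 p a b \<or> odd3 q a b"
      "2 \<le> card (bad I t p)" "2 \<le> card (bad I t q)"
      "\<And>n. n \<in> I \<Longrightarrow> \<not> (R y (t n) \<and> R p (t n) \<and> R q (t n))" for y p q
  proof -
    have c2: "card (bad I t y) = 2" using c(1,2) by simp
    then obtain i j where ij: "bad I t y = {i, j}" "i \<noteq> j" by (auto simp: card_2_iff)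
    have "card (I - bad I t y) = 2"
      using c2 card bad_subset[of I t y] finite_bad[OF fin] by (simp add: card_Diff_subset)
    then obtain k l where kl: "I - bad I t y = {k, l}" "k \<noteq> l" by (auto simp: card_2_iff)
    have I: "I = {i, j, k, l}" using ij(1) kl(1) bad_subset[of I t y] by blast
    have "k \<notin> {i, j}" "l \<notin> {i, j}" using kl ij by auto
    then have d: "distinct [i, j, k, l]" using ij kl by auto
    have y: "R y (t i)" "R y (t j)" using ij(1) by (auto simp: bad_def)
    have ny: "\<not> R y (t k)" "\<not> R y (t l)" using kl(1) by (auto simp: bad_def)
    show False
      using triangle_linked_four_two_bad[OF c(3-8) d I y ny c(11) c(9,10)] no by blast
  qed
  have "bad I t y \<inter> bad I t p \<inter> bad I t q = {}" using free by (auto simp: bad_def)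
  then have "card (bad I t y) + card (bad I t p) + card (bad I t q) \<le> 2 * card I"
    by (intro card_triple_sum[OF fin]) (simp_all add: bad_subset)
  then consider "card (bad I t y) \<le> 2" | "card (bad I t p) \<le> 2" | "card (bad I t q) \<le> 2"
    using card by linarith
  then show False
  proof cases
    case 1
    show False using 1 by (intro core[of y p q]) (use ge2 dist X red rs odd free in auto)
  next
    case 2
    show False using 2 by (intro core[of p y q]) (use ge2 dist X red rs odd free in auto)
  next
    case 3
    show False using 3 by (intro core[of q y p]) (use ge2 dist X red rs odd free in auto)
  qed
qed

section \<open>Choosing the attaching set\<close>

definition balanced :: "'b set \<Rightarrow> bool" where
  "balanced W \<longleftrightarrow> (\<forall>x\<in>W. \<forall>y\<in>W. \<forall>z\<in>W. distinct [x, y, z] \<longrightarrow> \<not> odd3 x y z)"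

definition blue_clique :: "'b set \<Rightarrow> bool" where
  "blue_clique B \<longleftrightarrow> (\<forall>x\<in>B. \<forall>y\<in>B. x \<noteq> y \<longrightarrow> \<not> R x y)"

lemma unbalancedE:
  assumes "\<not> balanced W"
  obtains x y z where "{x, y, z} \<subseteq> W" "distinct [x, y, z]" "odd3 x y z"
  using assms unfolding balanced_def by auto

text \<open>
A colouring without odd triangles is a cut: fix \<open>w\<close>; the red neighbours of \<open>w\<close> form a blue
clique, and so do the other vertices.
\<close>

lemma balanced_blue_clique:
  assumes "finite W" "balanced W"
  obtains B where "B \<subseteq> W" "blue_clique B" "card W \<le> 2 * card B"
proof (cases "W = {}")
  case True
  then show ?thesis using that[of "{}"] by (auto simp: blue_clique_def)
next
  case False
  then obtain w where w: "w \<in> W" by blast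
  define A where "A = {x \<in> W. x \<noteq> w \<and> R w x}"
  define B where "B = W - A"
  have even: "R x y = (R w x \<noteq> R w y)" if "x \<in> W" "y \<in> W" "distinct [w, x, y]" for x y
    using assms(2) w that unfolding balanced_def odd3_def by blast
  have "blue_clique A" unfolding blue_clique_def
  proof (intro ballI impI)
    fix x y assume "x \<in> A" "y \<in> A" "x \<noteq> y"
    then show "\<not> R x y" using even[of x y] by (auto simp: A_def)
  qed
  moreover have "blue_clique B" unfolding blue_clique_def
  proof (intro ballI impI)
    fix x y assume xy: "x \<in> B" "y \<in> B" "x \<noteq> y"
    then have "x = w \<or> \<not> R w x" "y = w \<or> \<not> R w y" "x \<in> W" "y \<in> W" by (auto simp: A_def B_def)
    then show "\<not> R x y" using even[of x y] xy(3) R_sym[of x w] by auto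
  qed
  moreover have "card W = card A + card B"
    using assms(1) by (simp add: A_def B_def card_Diff_subset card_mono)
  moreover have "A \<subseteq> W" "B \<subseteq> W" by (auto simp: A_def B_def)
  ultimately show ?thesis using that[of A] that[of B] by (cases "card A \<le> card B") auto
qed

text \<open>
The four triangles on four vertices have even total parity. So an odd triangle \<open>a b c\<close> disjoint from a given
vertex \<open>v\<close> yields an odd triangle through \<open>v\<close>.
\<close>

lemma odd3_extend:
  assumes "odd3 a b c"
  shows "odd3 v a b \<or> odd3 v b c \<or> odd3 v a c"
  using assms unfolding odd3_def by blast

lemma maximal_red_clique:
  assumes "finite V"
  obtains K where "K \<subseteq> V" "red_clique K" "\<And>K'. K' \<subseteq> V \<Longrightarrow> red_clique K' \<Longrightarrow> card K' \<le> card K"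
proof -
  define M where "M = {K. K \<subseteq> V \<and> red_clique K}"
  have "finite (card ` M)" using assms by (auto simp: M_def)
  moreover have "{} \<in> M" by (simp add: M_def red_clique_def)
  ultimately have "Max (card ` M) \<in> card ` M" by (intro Max_in) auto
  then obtain K where K: "K \<in> M" "card K = Max (card ` M)" by auto
  have "card K' \<le> card K" if "K' \<in> M" for K'
    unfolding K(2) using \<open>finite (card ` M)\<close> that by (intro Max_ge) auto
  then show ?thesis using that[of K] K(1) by (auto simp: M_def)
qed

lemma odd3_red_edge:
  assumes "odd3 x y z" "distinct [x, y, z]"
  obtains x' y' z' where "odd3 x' y' z'" "distinct [x', y', z']" "{x', y', z'} = {x, y, z}" "R x' y'"
proof -
  have "R x y \<or> R y z \<or> R x z" using assms(1) unfolding odd3_def by blast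
  moreover have "odd3 y z x" "odd3 x z y" using assms(1) odd3_swap12 odd3_swap23 by blast+
  ultimately show ?thesis
    using that[of x y z] that[of y z x] that[of x z y] assms by auto
qed

text \<open>
Removing a clique or triangle with at most four vertices leaves at least \<open>2 n - 1\<close> vertices when \<open>d \<ge> 4\<close>, so
what is left is still unbalanced and contains a second odd triangle. For \<open>d \<le> 3\<close> at most one is needed.
\<close>

lemma exists_attaching_set:
  assumes fin: "finite V" and d: "d \<le> 5" and n: "d < n" and N: "(d + 2) * n \<le> 2 * card V"
    and red_edge: "\<exists>x\<in>V. \<exists>y\<in>V. x \<noteq> y \<and> R x y"
    and unbal: "\<And>W. W \<subseteq> V \<Longrightarrow> 2 * n \<le> card W + 1 \<Longrightarrow> \<not> balanced W"
  shows "\<exists>X\<subseteq>V. card X = d + 1 \<and>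
    (\<forall>(I :: 'i set) t. finite I \<longrightarrow> card I = d \<longrightarrow> t ` I \<subseteq> V - X \<longrightarrow> (\<exists>x\<in>X. linked X I t x))"
proof -
  obtain K where KV: "K \<subseteq> V" and clique: "red_clique K"
    and max: "\<And>K'. K' \<subseteq> V \<Longrightarrow> red_clique K' \<Longrightarrow> card K' \<le> card K"
    using maximal_red_clique[OF fin] by metis
  have finK: "finite K" using KV fin finite_subset by blast
  have K2: "2 \<le> card K"
  proof -
    obtain x y where "x \<in> V" "y \<in> V" "x \<noteq> y" "R x y" using red_edge by blast
    then have "red_clique {x, y}" using R_symD unfolding red_clique_def by auto
    then show ?thesis using max[of "{x, y}"] \<open>x \<in> V\<close> \<open>y \<in> V\<close> \<open>x \<noteq> y\<close> by simp
  qed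
  have miss: "\<exists>y\<in>K'. \<not> R y u" if "K' \<subseteq> V" "red_clique K'" "card K' = card K" "u \<in> V" "u \<notin> K'" for K' u
  proof (rule ccontr)
    assume "\<not> ?thesis"
    then have "red_clique (insert u K')" using that(2) R_symD unfolding red_clique_def by blast
    then have "card (insert u K') \<le> card K" using that by (intro max) auto
    then show False using that(1,3,5) fin finite_subset[of K' V] by simp
  qed
  have edge_free: "\<not> (R x u \<and> R y u)"
    if "card K = 2" "x \<in> V" "y \<in> V" "R x y" "x \<noteq> y" "u \<in> V" "u \<noteq> x" "u \<noteq> y" for x y u
    using miss[of "{x, y}" u] that R_symD by (auto simp: red_clique_def)
  have tri_clique: "red_clique {x, y, z} \<and> R x y \<and> R x z \<and> R y z" if "K = {x, y, z}" "distinct [x, y, z]" for x y z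
    using clique that unfolding red_clique_def by auto
  have n_small: "2 * n \<le> card V" if "2 \<le> d"
    using order_trans[OF mult_le_mono1[of 4 "d + 2" n] N] that by simp
  have n4: "3 * n \<le> card V" if "4 \<le> d"
    using order_trans[OF mult_le_mono1[of 6 "d + 2" n] N] that by simp
  have rest: "\<not> balanced (V - T)" if "T \<subseteq> V" "card T \<le> 4" "4 \<le> d" for T
  proof -
    have "card (V - T) = card V - card T" using that(1) fin by (simp add: card_Diff_subset finite_subset)
    then show ?thesis using unbal[of "V - T"] n4[OF that(3)] that n by simp
  qed
  consider (large) "d < card K" | (full) "card K = d" "3 \<le> d" | (two) "card K = 2" "2 \<le> d"
    | (three) "card K = 3" "4 \<le> d" | (four) "card K = 4" "d = 5"
    using K2 d by linarith
  then show ?thesis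
  proof cases
    case large
    then obtain X where X: "X \<subseteq> K" "card X = d + 1" using obtain_subset_with_card_n[of "d + 1" K] by auto
    have "red_clique X" using clique X(1) unfolding red_clique_def by blast
    then have "\<exists>x\<in>X. linked X I t x" if "finite I" "card I = d" for I :: "'i set" and t
      using large_clique_linked[of I X X t] that X by simp
    then show ?thesis using X KV by (intro exI[of _ X]) auto
  next
    case full
    have "card K < card V" using full n n_small by simp
    then obtain v where v: "v \<in> V" "v \<notin> K" using KV by (metis less_irrefl subsetI subset_antisym)
    have "\<exists>x\<in>insert v K. linked (insert v K) I t x"
      if I: "finite I" "card I = d" "t ` I \<subseteq> V - insert v K" for I :: "'i set" and t
    proof -
      have "\<exists>y\<in>K. \<not> R y (t i)" if "i \<in> I" for i using miss[OF KV clique refl, of "t i"] I(3) that by blast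
      then show ?thesis
        using full_size_clique_linked[OF I(1), of K "insert v K" t] clique full I(2) by auto
    qed
    then show ?thesis using v KV full finK by (intro exI[of _ "insert v K"]) auto
  next
    case two
    have "\<not> balanced V" using unbal[of V] n_small[OF two(2)] by simp
    then obtain x0 y0 z0 where "{x0, y0, z0} \<subseteq> V" "distinct [x0, y0, z0]" "odd3 x0 y0 z0"
      by (rule unbalancedE)
    then obtain x y z where T: "{x, y, z} \<subseteq> V" "distinct [x, y, z]" "odd3 x y z" "R x y"
      using odd3_red_edge by metis
    have free: "\<not> (R x (t i) \<and> R y (t i))" if "i \<in> I" "t ` I \<subseteq> V - X" "{x, y, z} \<subseteq> X" for i I X and t :: "'i \<Rightarrow> 'b"
    proof -
      have "t i \<in> V - X" using that by blast
      then show ?thesis using edge_free[OF two(1), of x y "t i"] T that(3) by auto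
    qed
    consider "d = 2" | "d = 3" | "d = 4" | "d = 5" using two d by linarith
    then show ?thesis
    proof cases
      case 1
      have "\<exists>v\<in>{x, y, z}. linked {x, y, z} I t v"
        if "finite I" "card I = d" "t ` I \<subseteq> V - {x, y, z}" for I :: "'i set" and t
        by (rule edge_linked_one_triangle[OF T(3,2) _ T(4) that(1)]) (use that 1 free[of _ I t "{x, y, z}"] in auto)
      then show ?thesis using T 1 by (intro exI[of _ "{x, y, z}"]) auto
    next
      case 2
      have "card {x, y, z} < card V" using T(2) n n_small 2 by simp
      then obtain v where v: "v \<in> V" "v \<notin> {x, y, z}" using T(1) by (metis less_irrefl subsetI subset_antisym)
      have "\<exists>u\<in>{v, x, y, z}. linked {v, x, y, z} I t u"
        if "finite I" "card I = d" "t ` I \<subseteq> V - {v, x, y, z}" for I :: "'i set" and t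
        by (rule edge_linked_one_triangle[OF T(3,2) _ T(4) that(1)]) (use that 2 free[of _ I t "{v, x, y, z}"] in auto)
      then show ?thesis using T v 2 by (intro exI[of _ "{v, x, y, z}"]) auto
    next
      case 3
      have "\<not> balanced (V - {x, y, z})" using rest[of "{x, y, z}"] T 3 by simp
      then obtain a b c where abc: "{a, b, c} \<subseteq> V - {x, y, z}" "distinct [a, b, c]" "odd3 a b c"
        by (rule unbalancedE)
      obtain a b where ab: "{a, b} \<subseteq> V - {x, y, z}" "a \<noteq> b" "odd3 z a b"
        using odd3_extend[OF abc(3), of z] abc that[of a b] that[of b c] that[of a c] by auto
      have zxy: "odd3 z x y" using T(3) odd3_swap12 odd3_swap23 by blast
      have "\<exists>v\<in>{z, x, y, a, b}. linked {z, x, y, a, b} I t v"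
        if t: "finite I" "card I = d" "t ` I \<subseteq> V - {z, x, y, a, b}" for I :: "'i set" and t
      proof (rule edge_linked_four[OF zxy ab(3) _ order_refl t(1)])
        fix u w i assume uw: "u \<in> {z, x, y, a, b}" "w \<in> {z, x, y, a, b}" "R u w" "u \<noteq> w" "i \<in> I"
        then have "t i \<in> V" "t i \<noteq> u" "t i \<noteq> w" "u \<in> V" "w \<in> V" using t(3) T ab by auto
        then show "\<not> (R u (t i) \<and> R w (t i))" using edge_free[OF two(1)] uw by blast
      qed (use T ab 3 t in auto)
      then show ?thesis using T ab 3 by (intro exI[of _ "{z, x, y, a, b}"]) auto
    next
      case 4
      have "\<not> balanced (V - {x, y, z})" using rest[of "{x, y, z}"] T 4 by simp
      then obtain a b c where abc: "{a, b, c} \<subseteq> V - {x, y, z}" "distinct [a, b, c]" "odd3 a b c"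
        by (rule unbalancedE)
      let ?X = "{x, y, z, a, b, c}"
      have dist: "distinct [x, y, z, a, b, c]" using T abc by auto
      have "\<exists>v\<in>?X. linked ?X I t v"
        if "finite I" "card I = d" "t ` I \<subseteq> V - ?X" for I :: "'i set" and t
        by (rule edge_linked_two_triangles[OF T(3) abc(3) dist order_refl T(4) that(1)])
          (use that 4 free[of _ I t ?X] in auto)
      moreover have "card ?X = d + 1" "?X \<subseteq> V" using distinct_card[OF dist] 4 T abc by auto
      ultimately show ?thesis by (intro exI[of _ ?X]) auto
    qed
  next
    case three
    then obtain x y z where K: "K = {x, y, z}" "x \<noteq> y" "x \<noteq> z" "y \<noteq> z" by (auto simp: card_3_iff)
    have red: "R x y" "R x z" "R y z" using tri_clique K by auto
    have "\<not> balanced (V - K)" using rest[OF KV] three by simp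
    then obtain a b c where abc: "{a, b, c} \<subseteq> V - K" "distinct [a, b, c]" "odd3 a b c"
      by (rule unbalancedE)
    have free: "\<not> (R x (t i) \<and> R y (t i) \<and> R z (t i))" if "i \<in> I" "t ` I \<subseteq> V - X" "K \<subseteq> X"
      for i I X and t :: "'i \<Rightarrow> 'b"
    proof -
      have "t i \<in> V" "t i \<notin> K" using that by blast+
      then show ?thesis using miss[OF KV clique refl, of "t i"] K by auto
    qed
    consider "d = 4" | "d = 5" using three d by linarith
    then show ?thesis
    proof cases
      case 1
      obtain a b where ab: "{a, b} \<subseteq> V - K" "a \<noteq> b" "odd3 x a b"
        using odd3_extend[OF abc(3), of x] abc that[of a b] that[of b c] that[of a c] by auto
      let ?X = "{x, y, z, a, b}"
      have dist: "distinct [x, y, z, a, b]" using K ab by auto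
      have "\<exists>v\<in>?X. linked ?X I t v"
        if "finite I" "card I = d" "t ` I \<subseteq> V - ?X" for I :: "'i set" and t
        by (rule triangle_linked_four[OF dist order_refl red _ that(1)])
          (use that 1 ab free[of _ I t ?X] K in auto)
      moreover have "card ?X = d + 1" "?X \<subseteq> V" using distinct_card[OF dist] 1 K KV ab by auto
      ultimately show ?thesis by (intro exI[of _ ?X]) auto
    next
      case 2
      let ?X = "{x, y, z, a, b, c}"
      have dist: "distinct [x, y, z, a, b, c]" using K abc by auto
      have "\<exists>v\<in>?X. linked ?X I t v"
        if "finite I" "card I = d" "t ` I \<subseteq> V - ?X" for I :: "'i set" and t
        by (rule triangle_linked_five[OF abc(3) dist order_refl red that(1)])
          (use that 2 free[of _ I t ?X] K in auto)
      moreover have "card ?X = d + 1" "?X \<subseteq> V" using distinct_card[OF dist] 2 K KV abc by auto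
      ultimately show ?thesis by (intro exI[of _ ?X]) auto
    qed
  next
    case four
    have "\<not> balanced (V - K)" using rest[OF KV] four by simp
    then obtain a b c where abc: "{a, b, c} \<subseteq> V - K" "distinct [a, b, c]" "odd3 a b c"
      by (rule unbalancedE)
    obtain v where v: "v \<in> K" using K2 by fastforce
    obtain a b where ab: "a \<in> V" "a \<notin> K" "b \<in> V" "b \<notin> K" "a \<noteq> b" "odd3 v a b"
      using odd3_extend[OF abc(3), of v] abc that[of a b] that[of b c] that[of a c] by auto
    let ?X = "K \<union> {a, b}"
    have "\<exists>x\<in>?X. linked ?X I t x"
      if t: "finite I" "card I = d" "t ` I \<subseteq> V - ?X" for I :: "'i set" and t
    proof (rule four_clique_linked[OF clique four(1) v ab(6) order_refl ab(2,4,5) t(1)])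
      show "card I = 5" using t four by simp
      fix i assume "i \<in> I"
      then have "t i \<in> V" "t i \<notin> K" using t(3) by blast+
      then show "\<exists>y\<in>K. \<not> R y (t i)" using miss[OF KV clique refl] by blast
    qed
    moreover have "card ?X = d + 1" "?X \<subseteq> V" using ab finK four KV by auto
    ultimately show ?thesis by (intro exI[of _ ?X]) auto
  qed
qed

end

context coloring begin

section \<open>Building the subdivision vertex by vertex\<close>

text \<open>
The embedding of a subdivision of \<open>H\<close> with even paths into the complete graph on \<open>V\<close>. It keeps only the
data \<open>\<phi>\<close> and \<open>P\<close>, since they determine the subdivision.
\<close>

definition even_subdivision :: "'b set \<Rightarrow> 'a ugraph \<Rightarrow> ('a \<Rightarrow> 'b) \<Rightarrow> ('a set \<Rightarrow> 'b list) \<Rightarrow> bool" where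
  "even_subdivision V H \<phi> P \<longleftrightarrow>
     inj_on \<phi> (verts H) \<and> \<phi> ` verts H \<subseteq> V \<and>
     (\<forall>e\<in>edges H. P e \<noteq> [] \<and> distinct (P e) \<and> set (P e) \<subseteq> V \<and> \<not> odd_walk (P e) \<and>
        {hd (P e), last (P e)} = \<phi> ` e \<and> internal_verts (P e) \<inter> \<phi> ` verts H = {}) \<and>
     (\<forall>e\<in>edges H. \<forall>e'\<in>edges H. e \<noteq> e' \<longrightarrow> internal_verts (P e) \<inter> internal_verts (P e') = {})"

end

lemma edge_pairE:
  assumes "simple_graph H" "e \<in> edges H"
  obtains v w where "e = {v, w}" "v \<noteq> w" "v \<in> verts H" "w \<in> verts H"
  using assms unfolding simple_graph_def by (metis card_2_iff insert_subset)

lemma finite_edges: "simple_graph H \<Longrightarrow> finite (edges H)"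
  unfolding simple_graph_def by (meson Pow_iff finite_Pow_iff rev_finite_subset subsetI)

definition neighbours :: "'a ugraph \<Rightarrow> 'a \<Rightarrow> 'a set" where
  "neighbours H v = {w. {v, w} \<in> edges H}"

lemma neighbours_subset:
  assumes "simple_graph H"
  shows "neighbours H v \<subseteq> verts H - {v}"
proof
  fix w assume "w \<in> neighbours H v"
  then have "{v, w} \<subseteq> verts H" "card {v, w} = 2"
    using assms unfolding neighbours_def simple_graph_def by blast+
  then show "w \<in> verts H - {v}" by (cases "w = v") auto
qed

lemma incident_edges: "simple_graph H \<Longrightarrow> {e \<in> edges H. v \<in> e} = (\<lambda>w. {v, w}) ` neighbours H v"
proof (intro equalityI subsetI)
  fix e assume H: "simple_graph H" and "e \<in> {e \<in> edges H. v \<in> e}"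
  then have e: "e \<in> edges H" "v \<in> e" by auto
  obtain a b where "e = {a, b}" using edge_pairE[OF H e(1)] by metis
  then have "\<exists>w. e = {v, w}" using e(2) by auto
  then show "e \<in> (\<lambda>w. {v, w}) ` neighbours H v" using e(1) by (auto simp: neighbours_def)
qed (auto simp: neighbours_def)

lemma card_neighbours:
  assumes "simple_graph H"
  shows "card (neighbours H v) = vertex_degree H v"
proof -
  have "inj_on (\<lambda>w. {v, w}) (neighbours H v)"
    by (auto simp: inj_on_def doubleton_eq_iff)
  then show ?thesis
    unfolding vertex_degree_def incident_edges[OF assms] by (simp add: card_image)
qed

text \<open>
Double counting of the pairs of an edge and one of its ends.
\<close>

lemma sum_vertex_degree:
  assumes H: "simple_graph H"
  shows "(\<Sum>v\<in>verts H. vertex_degree H v) = 2 * card (edges H)"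
proof -
  have fin: "finite (verts H)" "finite (edges H)"
    using H finite_edges by (auto simp: simple_graph_def)
  have "(\<Sum>v\<in>verts H. vertex_degree H v) = (\<Sum>v\<in>verts H. \<Sum>e\<in>edges H. if v \<in> e then 1 else 0)"
    using fin by (simp add: vertex_degree_def sum.If_cases Int_def)
  also have "\<dots> = (\<Sum>e\<in>edges H. \<Sum>v\<in>verts H. if v \<in> e then 1 else 0)"
    by (rule sum.swap)
  also have "\<dots> = (\<Sum>e\<in>edges H. 2)"
  proof (rule sum.cong[OF refl])
    fix e assume "e \<in> edges H"
    then have "{v \<in> verts H. v \<in> e} = e" "card e = 2" using H by (auto simp: simple_graph_def)
    then show "(\<Sum>v\<in>verts H. if v \<in> e then 1 else 0) = (2 :: nat)"
      using fin by (simp add: sum.If_cases Int_def)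
  qed
  finally show ?thesis by simp
qed

definition remove_vertex :: "'a ugraph \<Rightarrow> 'a \<Rightarrow> 'a ugraph" where
  "remove_vertex H v = \<lparr>verts = verts H - {v}, edges = {e \<in> edges H. v \<notin> e}\<rparr>"

lemma subgraph_remove_vertex: "simple_graph H \<Longrightarrow> subgraph_of (remove_vertex H v) H"
  unfolding subgraph_of_def simple_graph_def remove_vertex_def by auto

lemma degenerate_subgraph: "degenerate d H \<Longrightarrow> subgraph_of H' H \<Longrightarrow> degenerate d H'"
  unfolding degenerate_def subgraph_of_def by (meson subset_trans)

lemma card_remove_vertex:
  assumes "simple_graph H"
  shows "card (edges (remove_vertex H v)) + vertex_degree H v = card (edges H)"
proof -
  have fin: "finite (edges H)" by (rule finite_edges[OF assms])
  have "edges H = edges (remove_vertex H v) \<union> {e \<in> edges H. v \<in> e}"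
    "edges (remove_vertex H v) \<inter> {e \<in> edges H. v \<in> e} = {}"
    by (auto simp: remove_vertex_def)
  then show ?thesis
    unfolding vertex_degree_def using fin card_Un_disjoint[of "edges (remove_vertex H v)" "{e \<in> edges H. v \<in> e}"]
    by (metis finite_Un)
qed

context coloring begin

lemma blue_clique_even_subdivision:
  assumes H: "simple_graph H" and B: "B \<subseteq> V" "blue_clique B" "finite B" "card (verts H) \<le> card B"
  shows "\<exists>\<phi> P. even_subdivision V H \<phi> P"
proof -
  have "finite (verts H)" using H by (simp add: simple_graph_def)
  then obtain \<phi> where \<phi>: "\<phi> ` verts H \<subseteq> B" "inj_on \<phi> (verts H)"
    using B(3,4) card_le_inj by metis
  define P where "P e = (SOME p. \<exists>a b. e = {a, b} \<and> a \<noteq> b \<and> a \<in> verts H \<and> b \<in> verts H \<and> p = [\<phi> a, \<phi> b])" for e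
  have P: "\<exists>a b. e = {a, b} \<and> a \<noteq> b \<and> a \<in> verts H \<and> b \<in> verts H \<and> P e = [\<phi> a, \<phi> b]" if "e \<in> edges H" for e
    unfolding P_def by (rule someI_ex) (use edge_pairE[OF H that] in metis)
  have "P e \<noteq> [] \<and> distinct (P e) \<and> set (P e) \<subseteq> V \<and> \<not> odd_walk (P e) \<and>
      {hd (P e), last (P e)} = \<phi> ` e \<and> internal_verts (P e) = {}" if e: "e \<in> edges H" for e
  proof -
    obtain a b where ab: "e = {a, b}" "a \<noteq> b" "a \<in> verts H" "b \<in> verts H" "P e = [\<phi> a, \<phi> b]"
      using P[OF e] by blast
    then have "\<phi> a \<noteq> \<phi> b" "\<phi> a \<in> B" "\<phi> b \<in> B" using \<phi> by (auto dest: inj_onD)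
    then show ?thesis using ab B(1,2) by (auto simp: blue_clique_def internal_verts_def)
  qed
  then have "even_subdivision V H \<phi> P"
    unfolding even_subdivision_def using \<phi> B(1) by auto
  then show ?thesis by blast
qed

text \<open>
The spare vertices of \<open>X\<close> are disjoint from everything used for \<open>H - v\<close>, so the new paths can only collide
with each other, and \<open>linked\<close> excludes that.
\<close>

lemma even_subdivision_add_vertex:
  fixes H :: "'a ugraph"
  assumes H: "simple_graph H" and v: "v \<in> verts H" and XV: "X \<subseteq> V"
    and sub: "even_subdivision (V - X) (remove_vertex H v) \<phi> P"
    and link: "linked X (neighbours H v) \<phi> x"
  shows "\<exists>\<phi>' P'. even_subdivision V H \<phi>' P'"
proof -
  let ?H = "remove_vertex H v"
  have vH: "verts ?H = verts H - {v}" and eH: "edges ?H = {e \<in> edges H. v \<notin> e}"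
    by (simp_all add: remove_vertex_def)
  have x: "x \<in> X" using link by (simp add: linked_def)
  obtain c where disj: "disjoint_family_on (\<lambda>w. set (c w)) (neighbours H v)"
    and c: "\<And>w. w \<in> neighbours H v \<Longrightarrow> distinct (c w) \<and> set (c w) \<subseteq> X - {x} \<and> \<not> odd_walk (x # c w @ [\<phi> w])"
    using link unfolding linked_def by blast
  have inj: "inj_on \<phi> (verts H - {v})" and img: "\<phi> ` (verts H - {v}) \<subseteq> V - X"
    using sub by (simp_all add: even_subdivision_def vH)
  have old: "P e \<noteq> []" "distinct (P e)" "set (P e) \<subseteq> V - X" "\<not> odd_walk (P e)"
    "{hd (P e), last (P e)} = \<phi> ` e" "internal_verts (P e) \<inter> \<phi> ` (verts H - {v}) = {}"
    if "e \<in> edges H" "v \<notin> e" for e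
    using sub that by (simp_all add: even_subdivision_def vH eH)
  have old_disj: "internal_verts (P e) \<inter> internal_verts (P e') = {}"
    if "e \<in> edges H" "v \<notin> e" "e' \<in> edges H" "v \<notin> e'" "e \<noteq> e'" for e e'
    using sub that by (simp add: even_subdivision_def vH eH)
  define other where "other e = (THE w. e = {v, w})" for e
  have other: "other {v, w} = w" for w
    unfolding other_def by (auto simp: doubleton_eq_iff)
  define \<phi>' where "\<phi>' = \<phi>(v := x)"
  define P' where "P' e = (if v \<in> e then x # c (other e) @ [\<phi> (other e)] else P e)" for e
  have new: "\<exists>w\<in>neighbours H v. e = {v, w} \<and> P' e = x # c w @ [\<phi> w]" if e: "e \<in> edges H" "v \<in> e" for e
  proof -
    obtain w where "w \<in> neighbours H v" "e = {v, w}"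
      using incident_edges[OF H, of v] e by blast
    then show ?thesis by (intro bexI[of _ w]) (simp_all add: P'_def other)
  qed
  have P'_old: "P' e = P e" if "v \<notin> e" for e using that by (simp add: P'_def)
  have nb: "w \<in> verts H - {v}" if "w \<in> neighbours H v" for w using neighbours_subset[OF H] that by blast
  have \<phi>w: "\<phi> w \<in> V - X" if "w \<in> neighbours H v" for w using nb[OF that] img by blast
  have int_new: "internal_verts (x # c w @ [\<phi> w]) = set (c w)" if "w \<in> neighbours H v" for w
    using c[OF that] \<phi>w[OF that] x by (auto simp: internal_verts_def)
  have int_old: "internal_verts (P e) \<subseteq> V - X" if "e \<in> edges H" "v \<notin> e" for e
    using old(3)[OF that] by (auto simp: internal_verts_def)
  have img': "\<phi>' ` verts H = insert x (\<phi> ` (verts H - {v}))"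
    using v by (auto simp: \<phi>'_def image_iff)
  have "even_subdivision V H \<phi>' P'"
    unfolding even_subdivision_def
  proof (intro conjI ballI impI)
    show "inj_on \<phi>' (verts H)"
    proof (rule inj_onI)
      fix a b assume ab: "a \<in> verts H" "b \<in> verts H" "\<phi>' a = \<phi>' b"
      have "\<phi> w \<noteq> x" if "w \<in> verts H" "w \<noteq> v" for w using img x that by blast
      then show "a = b" using ab inj x by (auto simp: \<phi>'_def inj_on_def split: if_splits)
    qed
    show "\<phi>' ` verts H \<subseteq> V" using img' img x XV by auto
  next
    fix e assume e: "e \<in> edges H"
    have "P' e \<noteq> [] \<and> distinct (P' e) \<and> set (P' e) \<subseteq> V \<and> \<not> odd_walk (P' e) \<and>
      {hd (P' e), last (P' e)} = \<phi>' ` e \<and> internal_verts (P' e) \<inter> \<phi>' ` verts H = {}"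
    proof (cases "v \<in> e")
      case True
      then obtain w where w: "w \<in> neighbours H v" "e = {v, w}" "P' e = x # c w @ [\<phi> w]"
        using new e by blast
      have "distinct (P' e)" "set (P' e) \<subseteq> V" "\<not> odd_walk (P' e)"
        using c[OF w(1)] \<phi>w[OF w(1)] x XV w(3) by auto
      moreover have "{hd (P' e), last (P' e)} = \<phi>' ` e"
        using w nb[OF w(1)] by (auto simp: \<phi>'_def)
      moreover have "internal_verts (P' e) \<inter> \<phi>' ` verts H = {}"
        unfolding w(3) int_new[OF w(1)] img' using c[OF w(1)] img by blast
      ultimately show ?thesis using w(3) by simp
    next
      case False
      have "{hd (P e), last (P e)} = \<phi>' ` e"
        using old(5)[OF e False] False by (auto simp: \<phi>'_def)
      moreover have "internal_verts (P e) \<inter> \<phi>' ` verts H = {}"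
        unfolding img' using old(6)[OF e False] int_old[OF e False] x by blast
      ultimately show ?thesis
        using old(1-4)[OF e False] unfolding P'_old[OF False] by auto
    qed
    then show "P' e \<noteq> []" "distinct (P' e)" "set (P' e) \<subseteq> V" "\<not> odd_walk (P' e)"
      "{hd (P' e), last (P' e)} = \<phi>' ` e" "internal_verts (P' e) \<inter> \<phi>' ` verts H = {}"
      by blast+
  next
    fix e e' assume e: "e \<in> edges H" and e': "e' \<in> edges H" and ne: "e \<noteq> e'"
    have mixed: "internal_verts (P' a) \<inter> internal_verts (P' b) = {}"
      if ab: "a \<in> edges H" "b \<in> edges H" "v \<in> a" "v \<notin> b" for a b
    proof -
      obtain w where w: "w \<in> neighbours H v" "P' a = x # c w @ [\<phi> w]" using new ab by blast
      show ?thesis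
        unfolding w(2) int_new[OF w(1)] P'_old[OF ab(4)] using c[OF w(1)] int_old[OF ab(2,4)] by blast
    qed
    show "internal_verts (P' e) \<inter> internal_verts (P' e') = {}"
    proof (cases "v \<in> e"; cases "v \<in> e'")
      assume "v \<in> e" "v \<in> e'"
      then obtain w w' where w: "w \<in> neighbours H v" "e = {v, w}" "P' e = x # c w @ [\<phi> w]"
        and w': "w' \<in> neighbours H v" "e' = {v, w'}" "P' e' = x # c w' @ [\<phi> w']"
        using new e e' by metis
      have "w \<noteq> w'" using w w' ne by blast
      then show ?thesis
        unfolding w(3) w'(3) int_new[OF w(1)] int_new[OF w'(1)]
        using disjoint_family_onD[OF disj w(1) w'(1)] by blast
    next
      assume "v \<notin> e" "v \<notin> e'"
      then show ?thesis using old_disj[OF e _ e' _ ne] by (simp add: P'_old)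
    next
      assume "v \<in> e" "v \<notin> e'"
      then show ?thesis using mixed[OF e e'] by blast
    next
      assume "v \<notin> e" "v \<in> e'"
      then show ?thesis using mixed[OF e' e] by (metis inf_commute)
    qed
  qed
  then show ?thesis by blast
qed

text \<open>
A vertex of minimum degree \<open>d\<close> is removed together with a set of \<open>d + 1\<close> vertices of \<open>V\<close>. Minimality gives
\<open>n d \<le> 2 m\<close>, which turns \<open>n + m \<le> card V\<close> into the lower bound on \<open>card V\<close> needed for choosing this set. If
there is no red edge or there is a large balanced set, then \<open>H\<close> embeds into a blue clique with \<open>n\<close> vertices.
\<close>

theorem even_subdivision_exists:
  fixes H :: "'a ugraph"
  assumes "simple_graph H" "degenerate 5 H" "finite V" "card (verts H) + card (edges H) \<le> card V"
  shows "\<exists>\<phi> P. even_subdivision V H \<phi> P"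
  using assms
proof (induction "card (verts H)" arbitrary: H V rule: less_induct)
  case less
  note H = less.prems(1) and V = less.prems(3,4)
  have finH: "finite (verts H)" using H by (simp add: simple_graph_def)
  show ?case
  proof (cases "verts H = {}")
    case True
    then show ?thesis using blue_clique_even_subdivision[OF H, of "{}" V] by (simp add: blue_clique_def)
  next
    case False
    then have "Min (vertex_degree H ` verts H) \<in> vertex_degree H ` verts H"
      using finH by (intro Min_in) auto
    then obtain v where v: "v \<in> verts H" "vertex_degree H v = Min (vertex_degree H ` verts H)" by auto
    define d n where "d = vertex_degree H v" and "n = card (verts H)"
    have min: "d \<le> vertex_degree H w" if "w \<in> verts H" for w
      unfolding d_def v(2) using that finH by (intro Min_le) auto
    have "subgraph_of H H" using H by (simp add: subgraph_of_def)
    then obtain w where "w \<in> verts H" "vertex_degree H w \<le> 5"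
      using less.prems(2) False unfolding degenerate_def by blast
    then have d5: "d \<le> 5" using min[of w] by simp
    have nb: "card (neighbours H v) = d" "neighbours H v \<subseteq> verts H - {v}"
      using card_neighbours[OF H] neighbours_subset[OF H] by (simp_all add: d_def)
    have "d < n"
      unfolding nb(1)[symmetric] n_def using nb(2) v(1) finH by (intro psubset_card_mono) auto
    have "n * d \<le> (\<Sum>w\<in>verts H. vertex_degree H w)"
      unfolding n_def using sum_bounded_below[of "verts H" d "vertex_degree H"] min by simp
    then have "n * d \<le> 2 * card (edges H)" by (simp add: sum_vertex_degree[OF H])
    then have N: "(d + 2) * n \<le> 2 * card V" using V(2) by (simp add: n_def algebra_simps)
    have blue: ?thesis if "B \<subseteq> V" "blue_clique B" "n \<le> card B" for B
      using blue_clique_even_subdivision[OF H that(1,2) finite_subset[OF that(1) V(1)]] that(3)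
      by (simp add: n_def)
    show ?thesis
    proof (cases "\<exists>x\<in>V. \<exists>y\<in>V. x \<noteq> y \<and> R x y")
      case False
      then have "blue_clique V" by (auto simp: blue_clique_def)
      then show ?thesis using blue[of V] V(2) by (simp add: n_def)
    next
      case red_edge: True
      show ?thesis
      proof (cases "\<exists>W\<subseteq>V. 2 * n \<le> card W + 1 \<and> balanced W")
        case True
        then obtain W where W: "W \<subseteq> V" "2 * n \<le> card W + 1" "balanced W" by blast
        then obtain B where "B \<subseteq> W" "blue_clique B" "card W \<le> 2 * card B"
          using balanced_blue_clique[of W] V(1) finite_subset by metis
        then show ?thesis using blue[of B] W by auto
      next
        case False
        then have unbal: "\<not> balanced W" if "W \<subseteq> V" "2 * n \<le> card W + 1" for W
          using that by blast
        have "\<exists>X\<subseteq>V. card X = d + 1 \<and> (\<forall>(I :: 'a set) t. finite I \<longrightarrow> card I = d \<longrightarrow> t ` I \<subseteq> V - X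
            \<longrightarrow> (\<exists>x\<in>X. linked X I t x))"
          by (rule exists_attaching_set[OF V(1) d5 \<open>d < n\<close> N red_edge unbal])
        then obtain X where X: "X \<subseteq> V" "card X = d + 1"
          and attach: "\<forall>(I :: 'a set) t. finite I \<longrightarrow> card I = d \<longrightarrow> t ` I \<subseteq> V - X \<longrightarrow> (\<exists>x\<in>X. linked X I t x)"
          by (elim exE conjE)
        let ?H = "remove_vertex H v"
        have sub: "subgraph_of ?H H" by (rule subgraph_remove_vertex[OF H])
        have cv: "card (verts ?H) = n - 1" using v(1) finH by (simp add: remove_vertex_def n_def)
        have "\<exists>\<phi> P. even_subdivision (V - X) ?H \<phi> P"
        proof (rule less.hyps)
          show "card (verts ?H) < card (verts H)" using cv \<open>d < n\<close> by (simp add: n_def)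
          show "simple_graph ?H" using sub by (simp add: subgraph_of_def)
          show "degenerate 5 ?H" by (rule degenerate_subgraph[OF less.prems(2) sub])
          show "finite (V - X)" using V(1) by simp
          have "card (V - X) = card V - (d + 1)"
            using X V(1) by (simp add: card_Diff_subset finite_subset)
          then show "card (verts ?H) + card (edges ?H) \<le> card (V - X)"
            using cv card_remove_vertex[OF H, of v] V(2) \<open>d < n\<close> by (simp add: d_def n_def)
        qed
        then obtain \<phi> P where emb: "even_subdivision (V - X) ?H \<phi> P" by blast
        then have "\<phi> ` neighbours H v \<subseteq> V - X"
          using nb(2) unfolding even_subdivision_def by (auto simp: remove_vertex_def)
        moreover have "finite (neighbours H v)" using nb(2) finH by (meson finite_Diff finite_subset)
        ultimately obtain x where "linked X (neighbours H v) \<phi> x"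
          using attach[rule_format, of "neighbours H v" \<phi>] nb(1) by auto
        then show ?thesis using even_subdivision_add_vertex[OF H v(1) X(1) emb] by blast
      qed
    qed
  qed
qed

end

section \<open>Path weights and the two bounds\<close>

lemma path_edges_Cons: "path_edges (x # y # p) = insert {x, y} (path_edges (y # p))"
proof
  show "path_edges (x # y # p) \<subseteq> insert {x, y} (path_edges (y # p))"
    unfolding path_edges_def
  proof
    fix e assume "e \<in> {{(x # y # p) ! i, (x # y # p) ! Suc i} |i. Suc i < length (x # y # p)}"
    then obtain i where "e = {(x # y # p) ! i, (x # y # p) ! Suc i}" "Suc i < length (x # y # p)" by blast
    then show "e \<in> insert {x, y} {{(y # p) ! i, (y # p) ! Suc i} |i. Suc i < length (y # p)}"
      by (cases i) auto
  qed
  show "insert {x, y} (path_edges (y # p)) \<subseteq> path_edges (x # y # p)"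
    unfolding path_edges_def
  proof
    fix e assume "e \<in> insert {x, y} {{(y # p) ! i, (y # p) ! Suc i} |i. Suc i < length (y # p)}"
    then consider "e = {x, y}" | i where "e = {(y # p) ! i, (y # p) ! Suc i}" "Suc i < length (y # p)" by blast
    then show "e \<in> {{(x # y # p) ! i, (x # y # p) ! Suc i} |i. Suc i < length (x # y # p)}"
    proof cases
      case 1 then show ?thesis by (intro CollectI exI[of _ 0]) simp
    next
      case 2 then show ?thesis by (intro CollectI exI[of _ "Suc i"]) simp
    qed
  qed
qed

lemma path_edges_subset: "e \<in> path_edges p \<Longrightarrow> e \<subseteq> set p"
  unfolding path_edges_def by (auto simp: nth_mem Suc_lessD)

lemma finite_path_edges: "finite (path_edges p)"
proof -
  have "path_edges p \<subseteq> Pow (set p)" using path_edges_subset by blast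
  then show ?thesis by (rule finite_subset) simp
qed

lemma card_path_edge:
  assumes "distinct p" "e \<in> path_edges p"
  shows "card e = 2"
proof -
  obtain i where "e = {p ! i, p ! Suc i}" "Suc i < length p" using assms(2) by (auto simp: path_edges_def)
  then show ?thesis using assms(1) by (simp add: nth_eq_iff_index_eq)
qed

lemma coloring_weight: "coloring (\<lambda>x y. \<omega> {x, y} = (1 :: int))"
  by unfold_locales (simp add: insert_commute)

text \<open>
The weight is a product over a set of edges, so splitting off the first edge needs that it does not
occur again, which holds because the vertices of the list are distinct.
\<close>

lemma path_weight_odd_walk:
  fixes \<omega> :: "'b set \<Rightarrow> int"
  assumes "distinct p" "\<forall>e\<in>path_edges p. \<omega> e \<in> {0, 1}"
  shows "path_weight 2 \<omega> p = (if coloring.odd_walk (\<lambda>x y. \<omega> {x, y} = 1) p then 1 else 0)"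
proof -
  interpret coloring "\<lambda>x y. \<omega> {x, y} = 1" by (rule coloring_weight)
  interpret Z: comm_group "integer_mod_group 2" by simp
  show ?thesis
    using assms
  proof (induction p rule: odd_walk.induct)
    case (1 x y p)
    have new: "{x, y} \<notin> path_edges (y # p)"
      using path_edges_subset[of "{x, y}" "y # p"] 1(2) by auto
    have carrier: "carrier (integer_mod_group 2) = {0, 1}"
      by (auto simp: carrier_integer_mod_group)
    have "path_weight 2 \<omega> (x # y # p) = (\<omega> {x, y} + path_weight 2 \<omega> (y # p)) mod 2"
      unfolding path_weight_def path_edges_Cons
      using new 1(3) by (subst Z.finprod_insert) (auto simp: finite_path_edges carrier path_edges_Cons)
    moreover have "path_weight 2 \<omega> (y # p) = (if odd_walk (y # p) then 1 else 0)"
      using 1 by (simp add: path_edges_Cons)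
    moreover have "\<omega> {x, y} = 0 \<or> \<omega> {x, y} = 1" using 1(3) by (simp add: path_edges_Cons)
    ultimately show ?case by auto
  qed (simp_all add: path_weight_def path_edges_def)
qed

lemma every_weighting_has_divisible_subdivision:
  fixes H :: "'a ugraph"
  assumes H: "simple_graph H" and deg: "degenerate 5 H" and f: "card (verts H) + card (edges H) \<le> f"
    and \<omega>: "edge_weighting 2 (complete_graph f) \<omega>"
  shows "has_divisible_subdivision 2 (complete_graph f) \<omega> H"
proof -
  interpret coloring "\<lambda>x y. \<omega> {x, y} = 1" by (rule coloring_weight)
  obtain \<phi> P where sub: "even_subdivision {..<f} H \<phi> P"
    using even_subdivision_exists[OF H deg, of "{..<f}"] f by auto
  then have inj: "inj_on \<phi> (verts H)" and img: "\<phi> ` verts H \<subseteq> {..<f}"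
    by (simp_all add: even_subdivision_def)
  have path: "P e \<noteq> []" "distinct (P e)" "set (P e) \<subseteq> {..<f}" "\<not> odd_walk (P e)"
    "{hd (P e), last (P e)} = \<phi> ` e" "internal_verts (P e) \<inter> \<phi> ` verts H = {}"
    if "e \<in> edges H" for e
    using sub that by (simp_all add: even_subdivision_def)
  define S where "S = \<lparr>verts = \<phi> ` verts H \<union> (\<Union>e\<in>edges H. set (P e)), edges = \<Union>e\<in>edges H. path_edges (P e)\<rparr>"
  have vS: "verts S \<subseteq> {..<f}" using img path(3) by (auto simp: S_def)
  have eS: "a \<subseteq> verts S \<and> card a = 2" if a: "a \<in> edges S" for a
  proof -
    obtain e where e: "e \<in> edges H" "a \<in> path_edges (P e)" using a by (auto simp: S_def)
    then show ?thesis
      using path_edges_subset[OF e(2)] card_path_edge[OF path(2)[OF e(1)] e(2)] by (auto simp: S_def)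
  qed
  have "subgraph_of S (complete_graph f)"
    unfolding subgraph_of_def simple_graph_def complete_graph_def
    using vS eS finite_subset[OF vS] by auto
  moreover have "subdivision_of S H \<phi> P"
    unfolding subdivision_of_def is_path_def
    using inj path sub by (auto simp: S_def even_subdivision_def)
  moreover have "path_weight 2 \<omega> (P e) = \<one>\<^bsub>integer_mod_group 2\<^esub>" if e: "e \<in> edges H" for e
  proof -
    have "\<omega> a \<in> {0, 1}" if "a \<in> path_edges (P e)" for a
    proof -
      have "a \<in> edges S" using that e by (auto simp: S_def)
      then have "a \<in> edges (complete_graph f)" using eS[of a] vS by (auto simp: complete_graph_def)
      then have "\<omega> a \<in> {0..<2}" using \<omega> by (simp add: edge_weighting_def carrier_integer_mod_group)
      then show ?thesis by auto
    qed
    then show ?thesis using path_weight_odd_walk[of "P e" \<omega>] path(2,4)[OF e] by simp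
  qed
  ultimately show ?thesis unfolding has_divisible_subdivision_def by blast
qed

text \<open>
With all weights 1, a path of weight 0 cannot be a single edge. So every subdivision path has an internal vertex,
and these vertices are distinct from each other and from the branch vertices.
\<close>

lemma constant_weighting_lower_bound:
  fixes H :: "'a ugraph"
  assumes H: "simple_graph H" and sub: "has_divisible_subdivision 2 (complete_graph f) (\<lambda>_. 1) H"
  shows "card (verts H) + card (edges H) \<le> f"
proof -
  interpret coloring "\<lambda>(_ :: nat) _. True" by unfold_locales simp
  obtain S \<phi> P where S: "subgraph_of S (complete_graph f)" "subdivision_of S H \<phi> P"
    and weight: "\<And>e. e \<in> edges H \<Longrightarrow> path_weight 2 (\<lambda>_. 1) (P e) = \<one>\<^bsub>integer_mod_group 2\<^esub>"
    using sub unfolding has_divisible_subdivision_def by blast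
  have inj: "inj_on \<phi> (verts H)"
    and path: "\<And>e. e \<in> edges H \<Longrightarrow> is_path S (P e) \<and> {hd (P e), last (P e)} = \<phi> ` e"
    and avoid: "\<And>e. e \<in> edges H \<Longrightarrow> internal_verts (P e) \<inter> \<phi> ` verts H = {}"
    and disj: "\<And>e e'. e \<in> edges H \<Longrightarrow> e' \<in> edges H \<Longrightarrow> e \<noteq> e' \<Longrightarrow> internal_verts (P e) \<inter> internal_verts (P e') = {}"
    and vS: "verts S = \<phi> ` verts H \<union> (\<Union>e\<in>edges H. set (P e))"
    using S(2) by (simp_all add: subdivision_of_def)
  have fin: "finite (verts H)" "finite (edges H)"
    using H finite_edges by (auto simp: simple_graph_def)
  have internal: "internal_verts (P e) \<noteq> {}" if e: "e \<in> edges H" for e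
  proof
    assume empty: "internal_verts (P e) = {}"
    obtain a b where ab: "e = {a, b}" "a \<noteq> b" "a \<in> verts H" "b \<in> verts H" using edge_pairE[OF H e] by metis
    then have "\<phi> a \<noteq> \<phi> b" using inj by (auto dest: inj_onD)
    then have ne: "hd (P e) \<noteq> last (P e)" using path[OF e] ab(1) by (auto simp: doubleton_eq_iff)
    have d: "distinct (P e)" "P e \<noteq> []" using path[OF e] by (auto simp: is_path_def)
    have set: "set (P e) \<subseteq> {hd (P e), last (P e)}" using empty by (auto simp: internal_verts_def)
    obtain x q where q: "P e = x # q" "q \<noteq> []" using d(2) ne by (cases "P e") (auto split: if_splits)
    then obtain y q' where q': "q = y # q'" by (cases q) auto
    have "q' = []"
    proof (cases q' rule: rev_cases)
      case (snoc r z)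
      have "y \<in> set (P e)" "hd (P e) = x" "last (P e) = z" using q q' snoc by auto
      then have "y \<in> {x, z}" using set by auto
      then show ?thesis using d(1) q q' snoc by auto
    qed
    then have "odd_walk (P e)" using q q' by simp
    moreover have "path_weight 2 (\<lambda>_. 1) (P e) = (if odd_walk (P e) then 1 else 0)"
      using path_weight_odd_walk[of "P e" "\<lambda>_. 1"] d by simp
    ultimately show False using weight[OF e] by simp
  qed
  have fin_int: "finite (internal_verts (P e))" for e by (simp add: internal_verts_def)
  have "card (edges H) = (\<Sum>e\<in>edges H. 1)" by simp
  also have "\<dots> \<le> (\<Sum>e\<in>edges H. card (internal_verts (P e)))"
    using internal fin_int by (intro sum_mono) (simp add: Suc_le_eq card_gt_0_iff)
  also have "\<dots> = card (\<Union>e\<in>edges H. internal_verts (P e))"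
    using disj fin fin_int by (intro card_UN_disjoint[symmetric]) auto
  finally have "card (verts H) + card (edges H)
      \<le> card (\<phi> ` verts H) + card (\<Union>e\<in>edges H. internal_verts (P e))"
    using inj by (simp add: card_image)
  also have "\<dots> = card (\<phi> ` verts H \<union> (\<Union>e\<in>edges H. internal_verts (P e)))"
    using avoid fin fin_int by (intro card_Un_disjoint[symmetric]) auto
  also have "\<dots> \<le> card {..<f}"
  proof (rule card_mono)
    have "internal_verts (P e) \<subseteq> set (P e)" for e by (auto simp: internal_verts_def)
    then have "\<phi> ` verts H \<union> (\<Union>e\<in>edges H. internal_verts (P e)) \<subseteq> verts S" unfolding vS by blast
    also have "verts S \<subseteq> {..<f}" using S(1) by (simp add: subgraph_of_def complete_graph_def)
    finally show "\<phi> ` verts H \<union> (\<Union>e\<in>edges H. internal_verts (P e)) \<subseteq> {..<f}" .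
  qed simp
  finally show ?thesis by simp
qed

theorem theorem1p4:
  fixes H :: "'a ugraph" and n m :: nat
  assumes "simple_graph H"
    and "degenerate 5 H"
    and "card (verts H) = n"
    and "card (edges H) = m"
  shows "s_div 2 H = enat (n + m)"
  unfolding s_div_def
proof (rule antisym)
  show "Inf {enat f |f. \<forall>\<omega>. edge_weighting 2 (complete_graph f) \<omega> \<longrightarrow>
      has_divisible_subdivision 2 (complete_graph f) \<omega> H} \<le> enat (n + m)"
    using every_weighting_has_divisible_subdivision[OF assms(1,2)] assms(3,4)
    by (intro Inf_lower CollectI exI[of _ "n + m"]) simp
  show "enat (n + m) \<le> Inf {enat f |f. \<forall>\<omega>. edge_weighting 2 (complete_graph f) \<omega> \<longrightarrow>
      has_divisible_subdivision 2 (complete_graph f) \<omega> H}"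
  proof (rule Inf_greatest)
    fix z assume "z \<in> {enat f |f. \<forall>\<omega>. edge_weighting 2 (complete_graph f) \<omega> \<longrightarrow>
      has_divisible_subdivision 2 (complete_graph f) \<omega> H}"
    then obtain f where f: "z = enat f"
      and all: "\<And>\<omega>. edge_weighting 2 (complete_graph f) \<omega> \<Longrightarrow> has_divisible_subdivision 2 (complete_graph f) \<omega> H"
      by blast
    have "edge_weighting 2 (complete_graph f) (\<lambda>_. 1)" by (simp add: edge_weighting_def)
    then have "n + m \<le> f"
      using constant_weighting_lower_bound[OF assms(1) all] assms(3,4) by simp
    then show "enat (n + m) \<le> z" using f by simp
  qed
qed

end
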